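(* Let $\alpha>-1$ and $n\in\mathbb{N}$. Let $\phi$ be an analytic self-map of $\mathbb{D}$ and let $\psi$ be an analytic function on $\mathbb{D}$, not identically zero, such that $D_{n,\psi,\phi}$ is bounded on $\mathcal{A}^2_\alpha$. Then $D_{n,\psi,\phi}$ is Hermitian if and only if there exist $a,c\in\mathbb{R}$ and $b\in\mathbb{D}$ such that $$\psi(z)=\frac{az^n}{(1-\overline{b}z)^{n+\alpha+2}}\quad\text{and}\quad\phi(z)=b+\frac{cz}{1-\overline{b}z}\quad\text{for all } z\in\mathbb{D}.$$
   Context: $\mathbb{D}=\{z\in\mathbb{C}:|z|<1\}$ and $\mathbb{N}=\{1,2,3,\dots\}$. For $-1<\alpha<\infty$, the weighted Bergman space $\mathcal{A}^2_\alpha$ is the Hilbert space of analytic functions $f$ on $\mathbb{D}$ with $\|f\|^2=\int_{\mathbb{D}}|f(z)|^2(\alpha+1)(1-|z|^2)^\alpha\,dA(z)<\infty$, where $dA$ is the normalized area measure on $\mathbb{D}$ (total mass 1). The weighted composition-differentiation operator is $(D_{n,\psi,\phi}f)(z)=\psi(z)f^{(n)}(\phi(z))$, where $f^{(n)}$ is the $n$-th derivative. "Bounded on $\mathcal{A}^2_\alpha$" means that it defines a bounded linear operator from $\mathcal{A}^2_\alpha$ to itself. A bounded operator $T$ is Hermitian if $T=T^*$. Non-integer powers $(1-\zeta)^s$ with $|\zeta|<1$ use the principal branch. *)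

theory Defs
  imports "HOL-Complex_Analysis.Complex_Analysis"
begin

abbreviation unit_disc :: "complex set" where
  "unit_disc \<equiv> ball 0 1"

(* The normalized area measure dA is uniform_measure lborel unit_disc. It vanishes off the disc, so
   the values of the weight there are irrelevant. *)
definition bergman_measure :: "real \<Rightarrow> complex measure" where
  "bergman_measure \<alpha> =
     density (uniform_measure lborel unit_disc)
       (\<lambda>z. ennreal ((\<alpha> + 1) * (1 - (cmod z)\<^sup>2) powr \<alpha>))"

(* A function on the disc is represented by its extension by zero to the whole plane. Hence
   functions that agree on the disc are equal, and the Bergman space is a genuine linear space
   of functions with a definite norm. *)
definition bergman_space :: "real \<Rightarrow> (complex \<Rightarrow> complex) set" where
  "bergman_space \<alpha> =
     {f. f holomorphic_on unit_disc \<and> (\<forall>z. z \<notin> unit_disc \<longrightarrow> f z = 0) \<and>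
         integrable (bergman_measure \<alpha>) (\<lambda>z. (cmod (f z))\<^sup>2)}"

definition bergman_inner :: "real \<Rightarrow> (complex \<Rightarrow> complex) \<Rightarrow> (complex \<Rightarrow> complex) \<Rightarrow> complex" where
  "bergman_inner \<alpha> f g = (\<integral>z. f z * cnj (g z) \<partial>bergman_measure \<alpha>)"

definition bergman_norm :: "real \<Rightarrow> (complex \<Rightarrow> complex) \<Rightarrow> real" where
  "bergman_norm \<alpha> f = sqrt (\<integral>z. (cmod (f z))\<^sup>2 \<partial>bergman_measure \<alpha>)"

definition bergman_bounded_operator ::
    "real \<Rightarrow> ((complex \<Rightarrow> complex) \<Rightarrow> (complex \<Rightarrow> complex)) \<Rightarrow> bool" where
  "bergman_bounded_operator \<alpha> T \<longleftrightarrow>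
     (\<forall>f\<in>bergman_space \<alpha>. T f \<in> bergman_space \<alpha>) \<and>
     (\<forall>f\<in>bergman_space \<alpha>. \<forall>g\<in>bergman_space \<alpha>. T (\<lambda>z. f z + g z) = (\<lambda>z. T f z + T g z)) \<and>
     (\<forall>f\<in>bergman_space \<alpha>. \<forall>k. T (\<lambda>z. k * f z) = (\<lambda>z. k * T f z)) \<and>
     (\<exists>C. \<forall>f\<in>bergman_space \<alpha>. bergman_norm \<alpha> (T f) \<le> C * bergman_norm \<alpha> f)"

(* The Hilbert space adjoint. For a bounded operator T, the described element exists by the
   Riesz representation theorem and is unique because the inner product is definite. *)
definition bergman_adjoint ::
    "real \<Rightarrow> ((complex \<Rightarrow> complex) \<Rightarrow> (complex \<Rightarrow> complex)) \<Rightarrow> (complex \<Rightarrow> complex) \<Rightarrow> (complex \<Rightarrow> complex)" where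
  "bergman_adjoint \<alpha> T g =
     (THE h. h \<in> bergman_space \<alpha> \<and>
        (\<forall>f\<in>bergman_space \<alpha>. bergman_inner \<alpha> (T f) g = bergman_inner \<alpha> f h))"

definition bergman_hermitian ::
    "real \<Rightarrow> ((complex \<Rightarrow> complex) \<Rightarrow> (complex \<Rightarrow> complex)) \<Rightarrow> bool" where
  "bergman_hermitian \<alpha> T \<longleftrightarrow> (\<forall>g\<in>bergman_space \<alpha>. T g = bergman_adjoint \<alpha> T g)"

definition weighted_comp_diff ::
    "nat \<Rightarrow> (complex \<Rightarrow> complex) \<Rightarrow> (complex \<Rightarrow> complex) \<Rightarrow> (complex \<Rightarrow> complex) \<Rightarrow> (complex \<Rightarrow> complex)" where
  "weighted_comp_diff n \<psi> \<phi> f =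
     (\<lambda>z. if z \<in> unit_disc then \<psi> z * (deriv ^^ n) f (\<phi> z) else 0)"

end

theory Submission
  imports Defs
begin

text \<open>
  Let \<open>T = weighted_comp_diff n \<psi> \<phi>\<close>. The Bergman space has the reproducing kernels \<open>K w z = (1 - cnj w * z) powr - (\<alpha> + 2)\<close>. Their derivatives with
  respect to \<open>cnj w\<close> (\<open>bergman_kernel \<alpha> n w\<close>) reproduce derivatives (\<open>bergman_reproducing\<close>). Hence the adjoint
  maps \<open>K w\<close> to \<open>cnj (\<psi> w)\<close> times the \<open>n\<close>-th derivative kernel at \<open>\<phi> w\<close>, whereas \<open>T\<close> maps \<open>K w\<close> to
  \<open>\<psi> z\<close> times the \<open>n\<close>-th derivative of \<open>K w\<close> at \<open>\<phi> z\<close>. As kernels determine the operator, \<open>T\<close> is Hermitian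
  if and only if these two functions of \<open>z\<close> agree for every \<open>w\<close> (\<open>weighted_comp_diff_hermitian_iff\<close>).
  With \<open>s = n + \<alpha> + 2\<close> this is the functional equation
  \<open>\<psi> z * cnj w ^ n * (1 - cnj (\<phi> w) * z) powr s = cnj (\<psi> w) * z ^ n * (1 - cnj w * \<phi> z) powr s\<close>,
  whose nonzero solutions are exactly the claimed pairs (\<open>kernel_symmetryD\<close>, \<open>kernel_symmetryI\<close>): dividing
  by \<open>z ^ n\<close> and putting \<open>w = 0\<close> determines \<open>\<psi>\<close>, and the remaining identity between powers forces
  \<open>(\<phi> z - b) * (1 - cnj b * z)\<close> to be a real multiple of \<open>z\<close>.

  The reproducing property rests on two facts about the measure. It is invariant under rotations, so
  monomials are orthogonal, and its radial part is a Beta distribution, so their squared norms are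
  \<open>k! / pochhammer (\<alpha> + 2) k\<close>; the reciprocals are the binomial coefficients of the kernel. Taylor series
  converge in norm (\<open>bergman_taylor_sum_tendsto\<close>), which turns the inner product into a weighted sum over
  Taylor coefficients (\<open>bergman_inner_sums\<close>) and makes the kernels sufficient for testing a bounded
  operator (\<open>bergman_hermitianI_kernel\<close>).
\<close>

section \<open>Rotation invariance of the area measure\<close>

text \<open>
  The area of a ball depends on its radius only, so a rotation preserves the area of every ball. By
  Vitali's theorem countably many disjoint balls inside \<open>U\<close> exhaust it up to a null set, and the
  rotated balls are disjoint inside the rotated set.
  The reverse inequality is the same statement for the inverse rotation.
\<close>

lemma emeasure_rotate_open_ge:
  fixes U :: "complex set"
  assumes u: "cmod u = 1" and U: "open U"
  shows "emeasure lborel U \<le> emeasure lborel ((*) u -` U)"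
proof -
  define K where "K = {(c::complex, r::real). ball c r \<subseteq> U}"
  obtain C where C: "countable C" "C \<subseteq> K"
     and dj: "pairwise (\<lambda>i j. disjnt (ball (fst i) (snd i)) (ball (fst j) (snd j))) C"
     and neg: "negligible (U - (\<Union>i \<in> C. ball (fst i) (snd i)))"
  proof (rule Vitali_covering_theorem_balls [of U K fst snd])
    fix x d assume "x \<in> U" "(0::real) < d"
    then obtain e where "e > 0" "ball x e \<subseteq> U" using U open_contains_ball by blast
    then have "(x, min e (d/2)) \<in> K" using \<open>0<d\<close> by (auto simp: K_def)
    then show "\<exists>i. i \<in> K \<and> x \<in> ball (fst i) (snd i) \<and> snd i < d"
      using \<open>0<d\<close> \<open>e>0\<close> by (intro exI[of _ "(x, min e (d/2))"]) auto
  qed blast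
  have pre: "(*) u -` ball c r = ball (cnj u * c) r" for c r
  proof -
    have "cmod (c - u * z) = cmod (cnj u * c - z)" for z
    proof -
      have "c - u * z = u * (cnj u * c - z)"
        using u by (simp add: algebra_simps complex_norm_square[symmetric] flip: mult.assoc)
      then show ?thesis using u by (simp add: norm_mult)
    qed
    then show ?thesis by (auto simp: dist_norm)
  qed
  have df: "disjoint_family_on (\<lambda>i. ball (fst i) (snd i)) C"
    using dj unfolding disjoint_family_on_def pairwise_def disjnt_def by blast
  have df': "disjoint_family_on (\<lambda>i. (*) u -` ball (fst i) (snd i)) C"
    using df unfolding disjoint_family_on_def by blast
  have nz: "U - (\<Union>i \<in> C. ball (fst i) (snd i)) \<in> null_sets lborel"
  proof -
    have "U - (\<Union>i \<in> C. ball (fst i) (snd i)) \<in> sets lborel" 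
      using U by (intro sets.Diff) (auto intro!: borel_open open_UN)
    then show ?thesis using neg by (simp add: negligible_iff_null_sets null_sets_completion_iff)
  qed
  have "emeasure lborel U \<le> emeasure lborel ((\<Union>i \<in> C. ball (fst i) (snd i)) \<union> (U - (\<Union>i \<in> C. ball (fst i) (snd i))))"
    using U by (intro emeasure_mono) (auto intro!: sets.Un sets.Diff borel_open open_UN)
  also have "\<dots> = emeasure lborel (\<Union>i \<in> C. ball (fst i) (snd i))"
    using nz by (intro emeasure_Un_null_set) (auto intro!: borel_open open_UN)
  also have "\<dots> = (\<integral>\<^sup>+i. emeasure lborel (ball (fst i) (snd i)) \<partial>count_space C)"
    using C df by (intro emeasure_UN_countable) auto
  also have "\<dots> = (\<integral>\<^sup>+i. emeasure lborel ((*) u -` ball (fst i) (snd i)) \<partial>count_space C)"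
    unfolding pre
  proof (intro nn_integral_cong)
    fix i :: "complex \<times> real"
    show "emeasure lborel (ball (fst i) (snd i)) = emeasure lborel (ball (cnj u * fst i) (snd i))"
      by (cases "snd i \<ge> 0") (simp_all add: emeasure_ball ball_empty)
  qed
  also have "\<dots> = emeasure lborel (\<Union>i \<in> C. (*) u -` ball (fst i) (snd i))"
    using C df' by (intro emeasure_UN_countable[symmetric]) (auto simp: pre)
  also have "\<dots> \<le> emeasure lborel ((*) u -` U)"
  proof (rule emeasure_mono)
    show "(\<Union>i\<in>C. (*) u -` ball (fst i) (snd i)) \<subseteq> (*) u -` U"
      using C(2) by (fastforce simp: K_def)
    show "(*) u -` U \<in> sets lborel"
      using U by (auto intro!: borel_open open_vimage continuous_intros)
  qed
  finally show ?thesis .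
qed

lemma lborel_rotate:
  assumes u: "cmod u = 1"
  shows "distr lborel borel ((*) u) = lborel"
proof (rule sym, rule lborel_eqI)
  fix l v :: complex assume le: "\<And>b. b \<in> Basis \<Longrightarrow> l \<bullet> b \<le> v \<bullet> b"
  have op: "open ((*) u -` box l v)"
    by (auto intro!: open_vimage continuous_intros)
  have "(*) (cnj u) -` ((*) u -` box l v) = box l v"
    using u by (auto simp: complex_norm_square[symmetric] mult.assoc[symmetric])
  then have "emeasure lborel ((*) u -` box l v) = emeasure lborel (box l v)"
    using emeasure_rotate_open_ge[OF u, of "box l v"]
      emeasure_rotate_open_ge[of "cnj u", OF _ op] u by (simp add: open_box)
  then show "emeasure (distr lborel borel ((*) u)) (box l v) = (\<Prod>b\<in>Basis. (v - l) \<bullet> b)"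
    using le by (simp add: emeasure_distr emeasure_lborel_box_eq)
qed simp

section \<open>The weighted measure on the disc\<close>

lemma ball_borel [measurable]: "ball (c::complex) r \<in> sets borel"
  by simp

lemma sets_bergman_measure [simp, measurable_cong]: "sets (bergman_measure \<alpha>) = sets borel"
  by (simp add: bergman_measure_def uniform_measure_def)

lemma space_bergman_measure [simp]: "space (bergman_measure \<alpha>) = UNIV"
  by (simp add: bergman_measure_def uniform_measure_def)

lemma nn_integral_bergman:
  assumes [measurable]: "f \<in> borel_measurable borel"
  shows "(\<integral>\<^sup>+z. f z \<partial>bergman_measure \<alpha>) =
    (\<integral>\<^sup>+z. (indicator unit_disc z / emeasure lborel unit_disc) * (ennreal ((\<alpha> + 1) * (1 - (cmod z)\<^sup>2) powr \<alpha>) * f z) \<partial>lborel)"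
  unfolding bergman_measure_def uniform_measure_def
  unfolding divide_ennreal_def by (subst nn_integral_density, measurable, subst nn_integral_density) auto

lemma bergman_measure_rotate:
  assumes u: "cmod u = 1"
  shows "distr (bergman_measure \<alpha>) borel ((*) u) = bergman_measure \<alpha>"
proof (rule measure_eqI)
  fix A assume "A \<in> sets (distr (bergman_measure \<alpha>) borel ((*) u))"
  then have A [measurable]: "A \<in> sets borel" by simp
  let ?w = "\<lambda>z. (indicator unit_disc z / emeasure lborel unit_disc) *
     (ennreal ((\<alpha> + 1) * (1 - (cmod z)\<^sup>2) powr \<alpha>) * indicator A z)"
  have "emeasure (distr (bergman_measure \<alpha>) borel ((*) u)) A = (\<integral>\<^sup>+z. indicator A z \<partial>distr (bergman_measure \<alpha>) borel ((*) u))"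
    by simp
  also have "\<dots> = (\<integral>\<^sup>+z. indicator A (u * z) \<partial>bergman_measure \<alpha>)"
    by (subst nn_integral_distr) auto
  also have "\<dots> = (\<integral>\<^sup>+z. ?w (u * z) \<partial>lborel)"
    using u by (subst nn_integral_bergman) (auto simp: norm_mult indicator_def intro!: nn_integral_cong)
  also have "\<dots> = (\<integral>\<^sup>+z. ?w z \<partial>distr lborel borel ((*) u))"
    unfolding divide_ennreal_def by (subst nn_integral_distr) auto
  also have "\<dots> = emeasure (bergman_measure \<alpha>) A"
    unfolding lborel_rotate[OF u] by (subst nn_integral_bergman[symmetric]) auto
  finally show "emeasure (distr (bergman_measure \<alpha>) borel ((*) u)) A = emeasure (bergman_measure \<alpha>) A" .
qed simp

lemma emeasure_unit_disc: "emeasure lborel unit_disc = ennreal pi"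
  by (simp add: emeasure_ball unit_ball_vol_2)

text \<open>
  The disc of radius \<open>sqrt x\<close> has area \<open>pi * x\<close>, so that \<open>|z|\<^sup>2\<close> is uniformly distributed on the unit
  interval. This replaces polar coordinates: integrals of radial functions over the disc become
  one-dimensional integrals.
\<close>

lemma distr_uniform_disc_norm_squared:
  "distr (uniform_measure lborel unit_disc) borel (\<lambda>z. (cmod z)\<^sup>2) = uniform_measure lborel {0..1::real}"
proof (rule measure_eqI_lessThan)
  fix x :: real
  have e: "emeasure (distr (uniform_measure lborel unit_disc) borel (\<lambda>z. (cmod z)\<^sup>2)) {x<..} =
     emeasure lborel (unit_disc \<inter> {z. x < (cmod z)\<^sup>2}) / ennreal pi"
    by (subst emeasure_distr) (auto simp: emeasure_unit_disc vimage_def)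
  have e': "emeasure (uniform_measure lborel {0..1::real}) {x<..} = emeasure lborel ({0..1} \<inter> {x<..})"
    by (simp add: divide_ennreal_def)
  consider "x < 0" | "x \<ge> 1" | "0 \<le> x" "x < 1" by linarith
  then have "emeasure lborel (unit_disc \<inter> {z. x < (cmod z)\<^sup>2}) / ennreal pi = emeasure lborel ({0..1} \<inter> {x<..})"
  proof cases
    case 1
    then have "unit_disc \<inter> {z. x < (cmod z)\<^sup>2} = unit_disc"
      by (auto intro: less_le_trans[of _ 0])
    moreover have "{0..1} \<inter> {x<..} = {0..1}" using 1 by auto
    ultimately show ?thesis by (simp add: emeasure_unit_disc divide_ennreal)
  next
    case 2
    then have "unit_disc \<inter> {z. x < (cmod z)\<^sup>2} = {}"
      by (auto simp: not_less) (smt (verit, best) norm_ge_zero power_le_one)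
    moreover have "{0..1} \<inter> {x<..} = {}" using 2 by auto
    ultimately show ?thesis by simp
  next
    case 3
    have "unit_disc \<inter> {z. x < (cmod z)\<^sup>2} = unit_disc - cball 0 (sqrt x)"
      using 3 by (auto simp: not_le real_less_lsqrt real_less_rsqrt) (metis not_le real_sqrt_abs abs_norm_cancel real_sqrt_le_iff)+
    moreover have "emeasure lborel (unit_disc - cball 0 (sqrt x)) = ennreal pi - ennreal (pi * x)"
    proof (subst emeasure_Diff)
      show "emeasure lborel (cball (0::complex) (sqrt x)) \<noteq> \<infinity>" using 3 by (simp add: emeasure_cball)
    qed (use 3 in \<open>auto simp: emeasure_cball emeasure_ball unit_ball_vol_2\<close>,
         smt (verit) real_sqrt_lt_1_iff)
    moreover have "{0..1} \<inter> {x<..} = {x<..1}" using 3 by auto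
    ultimately show ?thesis using 3
      by (simp add: ennreal_minus divide_ennreal mult_left_le) (simp add: field_simps)
  qed
  then show "emeasure (distr (uniform_measure lborel unit_disc) borel (\<lambda>z. (cmod z)\<^sup>2)) {x<..} =
     emeasure (uniform_measure lborel {0..1::real}) {x<..}" using e e' by simp
  show "emeasure (distr (uniform_measure lborel unit_disc) borel (\<lambda>z. (cmod z)\<^sup>2)) {x<..} < \<infinity>"
  proof -
    have "emeasure lborel (unit_disc \<inter> {z. x < (cmod z)\<^sup>2}) \<le> ennreal pi"
      unfolding emeasure_unit_disc[symmetric] by (intro emeasure_mono) auto
    then show ?thesis unfolding e
      by (metis ennreal_divide_eq_top_iff ennreal_less_top infinity_ennreal_def ennreal_eq_0_iff less_top not_le order_le_less_trans pi_gt_zero)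
  qed
qed auto

text \<open>
  The squared norm of \<open>z ^ k\<close> in the Bergman space. In this form the reciprocals are visibly the
  binomial coefficients of \<open>(1 - x) powr - (\<alpha> + 2)\<close>, which is what makes the reproducing kernel a power.
\<close>

definition bergman_moment :: "real \<Rightarrow> nat \<Rightarrow> real" where
  "bergman_moment \<alpha> k = fact k / pochhammer (\<alpha> + 2) k"

lemma bergman_moment_pos: "\<alpha> > -1 \<Longrightarrow> bergman_moment \<alpha> k > 0"
  by (simp add: bergman_moment_def pochhammer_pos)

lemma bergman_moment_Beta:
  assumes "\<alpha> > -1"
  shows "bergman_moment \<alpha> k = (\<alpha> + 1) * Beta (real k + 1) (\<alpha> + 1)"
proof -
  have np: "\<alpha> + 2 \<notin> \<int>\<^sub>\<le>\<^sub>0" "\<alpha> + 1 \<notin> \<int>\<^sub>\<le>\<^sub>0" using assms nonpos_Ints_nonpos[of "\<alpha>+2"] nonpos_Ints_nonpos[of "\<alpha>+1"] by auto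
  have G: "Gamma (\<alpha>+1) > 0" using assms by (simp add: Gamma_real_pos)
  have "Gamma (\<alpha> + 2) = (\<alpha> + 1) * Gamma (\<alpha>+1)"
    using Gamma_plus1[OF np(2)] by (simp add: add.assoc)
  moreover have "Gamma (\<alpha> + 2) > 0" using assms by (simp add: Gamma_real_pos)
  moreover have "pochhammer (\<alpha> + 2) k = Gamma (\<alpha> + 2 + real k) / Gamma (\<alpha> + 2)"
    using pochhammer_Gamma[OF np(1), of k] by simp
  ultimately have p: "Gamma (real k + 1 + (\<alpha> + 1)) = pochhammer (\<alpha> + 2) k * (\<alpha> + 1) * Gamma (\<alpha>+1)"
    using less_imp_neq[OF G] assms by (simp add: add_ac eq_commute[of 0])
  have "Gamma (real k + 1) = fact k" using Gamma_fact[of k, where ?'a = real] by (simp add: add.commute)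
  then have "(\<alpha> + 1) * Beta (real k + 1) (\<alpha> + 1) =
      fact k * ((\<alpha> + 1) * Gamma (\<alpha>+1)) / (pochhammer (\<alpha> + 2) k * ((\<alpha> + 1) * Gamma (\<alpha>+1)))"
    unfolding Beta_def p by (simp add: mult_ac)
  also have "\<dots> = bergman_moment \<alpha> k"
    unfolding bergman_moment_def using less_imp_neq[OF G] assms by (subst mult_divide_mult_cancel_right) auto
  finally show ?thesis ..
qed

lemma nn_integral_norm_power:
  assumes "\<alpha> > -1"
  shows "(\<integral>\<^sup>+z. ennreal ((cmod z) ^ (2 * k)) \<partial>bergman_measure \<alpha>) = ennreal (bergman_moment \<alpha> k)"
proof -
  let ?U = "uniform_measure lborel unit_disc"
  let ?g = "\<lambda>t::real. ennreal ((\<alpha> + 1) * (1 - t) powr \<alpha> * t ^ k)"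
  have "(\<integral>\<^sup>+z. ennreal ((cmod z) ^ (2 * k)) \<partial>bergman_measure \<alpha>) = (\<integral>\<^sup>+z. ?g ((cmod z)\<^sup>2) \<partial>?U)"
    unfolding bergman_measure_def using assms
    by (subst nn_integral_density) (auto simp: ennreal_mult' power_mult uniform_measure_def intro!: nn_integral_cong)
  also have "\<dots> = (\<integral>\<^sup>+t. ?g t \<partial>distr ?U borel (\<lambda>z. (cmod z)\<^sup>2))"
    by (subst nn_integral_distr) (auto simp: uniform_measure_def)
  also have "\<dots> = (\<integral>\<^sup>+t. ?g t * indicator {0..1} t \<partial>lborel)"
    unfolding distr_uniform_disc_norm_squared
    by (subst nn_integral_uniform_measure) (auto simp: divide_ennreal_def)
  also have "\<dots> = (\<integral>\<^sup>+t. ennreal ((\<alpha> + 1) * (t powr ((real k + 1) - 1) * (1 - t) powr ((\<alpha>+1) - 1))) * indicator {0..1} t \<partial>lborel)"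
  proof (rule nn_integral_cong_AE)
    have "AE t in lborel. t \<noteq> (0::real)" by (rule AE_lborel_singleton)
    then show "AE t in lborel. ?g t * indicator {0..1} t =
       ennreal ((\<alpha> + 1) * (t powr ((real k + 1) - 1) * (1 - t) powr ((\<alpha>+1) - 1))) * indicator {0..1} t"
      by eventually_elim (auto simp: indicator_def powr_realpow mult_ac)
  qed
  also have "\<dots> = ennreal ((\<alpha> + 1) * Beta (real k + 1) (\<alpha> + 1))"
  proof (rule nn_integral_has_integral_lebesgue')
    show "((\<lambda>t. (\<alpha> + 1) * (t powr ((real k + 1) - 1) * (1 - t) powr ((\<alpha>+1) - 1))) has_integral
       ((\<alpha> + 1) * Beta (real k + 1) (\<alpha> + 1))) {0..1}"
      using assms by (intro has_integral_mult_right has_integral_Beta_real) auto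
  qed (use assms in auto)
  finally show ?thesis using assms by (simp add: bergman_moment_Beta)
qed

lemma borel_measurable_cnj [measurable (raw)]:
  "f \<in> borel_measurable M \<Longrightarrow> (\<lambda>x. cnj (f x)) \<in> borel_measurable M"
  by (intro borel_measurable_continuous_on[of cnj] continuous_intros)

lemma AE_bergman_unit_disc: "AE z in bergman_measure \<alpha>. z \<in> unit_disc"
proof -
  have "emeasure (bergman_measure \<alpha>) (- unit_disc) = (\<integral>\<^sup>+z. indicator (- unit_disc) z \<partial>bergman_measure \<alpha>)"
    by simp
  also have "\<dots> = (\<integral>\<^sup>+(z::complex). 0 \<partial>lborel)"
    by (subst nn_integral_bergman) (auto intro!: nn_integral_cong simp: indicator_def nn_integral_0_iff_AE split: if_splits)
  finally have "- unit_disc \<in> null_sets (bergman_measure \<alpha>)" by (auto simp: null_sets_def)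
  then show ?thesis by (rule AE_I') auto
qed

section \<open>The Bergman space and its inner product\<close>

text \<open>
  The extension by zero makes the monomial a member of the Bergman space, whose elements vanish off
  the disc. Taylor expansions in these monomials then hold on the whole plane.
\<close>

definition disc_monomial :: "nat \<Rightarrow> complex \<Rightarrow> complex" where
  "disc_monomial k z = (if z \<in> unit_disc then z ^ k else 0)"

definition taylor_coeff :: "(complex \<Rightarrow> complex) \<Rightarrow> nat \<Rightarrow> complex" where
  "taylor_coeff f k = (deriv ^^ k) f 0 / fact k"

definition taylor_sum :: "(complex \<Rightarrow> complex) \<Rightarrow> nat \<Rightarrow> complex \<Rightarrow> complex" where
  "taylor_sum f N z = (\<Sum>k<N. taylor_coeff f k * disc_monomial k z)"

lemma taylor_coeff_unique:
  assumes "\<And>z. z \<in> unit_disc \<Longrightarrow> (\<lambda>k. c k * z ^ k) sums f z"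
  shows "taylor_coeff f k = c k"
proof -
  have "f has_fps_expansion Abs_fps c"
    using assms by (intro has_fps_expansionI eventually_nhds_in_open[of unit_disc, THEN eventually_mono]) auto
  from fps_nth_fps_expansion[OF this, of k] show ?thesis by (simp add: taylor_coeff_def)
qed

lemma powser_zero_coeff:
  assumes "\<And>z. z \<in> unit_disc \<Longrightarrow> (\<lambda>k. c k * z ^ k) sums 0"
  shows "c k = (0 :: complex)"
  using taylor_coeff_unique[of c "\<lambda>_. 0" k] taylor_coeff_unique[of "\<lambda>_. 0" "\<lambda>_. 0" k] assms by simp

lemma bergman_space_sums:
  assumes "f \<in> bergman_space \<alpha>"
  shows "(\<lambda>k. taylor_coeff f k * disc_monomial k z) sums f z"
proof (cases "z \<in> unit_disc")
  case True
  with assms holomorphic_power_series[of f 0 1 z] show ?thesis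
    by (simp add: bergman_space_def taylor_coeff_def disc_monomial_def)
next
  case False
  with assms show ?thesis by (simp add: bergman_space_def disc_monomial_def)
qed

lemma bergman_space_eqI:
  assumes "f \<in> bergman_space \<alpha>" "g \<in> bergman_space \<alpha>" "\<And>k. taylor_coeff f k = taylor_coeff g k"
  shows "f = g"
  using bergman_space_sums[OF assms(1)] bergman_space_sums[OF assms(2)] assms(3)
  by (auto intro: sums_unique2)

lemma bergman_space_measurable [measurable_dest]:
  assumes "f \<in> bergman_space \<alpha>"
  shows "f \<in> borel_measurable borel"
proof -
  have "(\<lambda>z. indicator unit_disc z *\<^sub>R f z) \<in> borel_measurable borel"
    using assms by (intro borel_measurable_continuous_on_indicator) 
      (auto simp: bergman_space_def intro: holomorphic_on_imp_continuous_on)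
  also have "(\<lambda>z. indicator unit_disc z *\<^sub>R f z) = f"
    using assms by (auto simp: bergman_space_def indicator_def fun_eq_iff)
  finally show ?thesis .
qed

lemma bergman_integrable_inner:
  assumes f: "f \<in> bergman_space \<alpha>" and g: "g \<in> bergman_space \<alpha>"
  shows "integrable (bergman_measure \<alpha>) (\<lambda>z. f z * cnj (g z))"
proof (rule Bochner_Integration.integrable_bound)
  show "integrable (bergman_measure \<alpha>) (\<lambda>z. (cmod (f z))\<^sup>2 + (cmod (g z))\<^sup>2)"
    using f g by (simp add: bergman_space_def)
  note [measurable] = bergman_space_measurable[OF f] bergman_space_measurable[OF g]
  show "(\<lambda>z. f z * cnj (g z)) \<in> borel_measurable (bergman_measure \<alpha>)"
    by measurable
  have "a * b \<le> a\<^sup>2 + b\<^sup>2" if "a \<ge> 0" "b \<ge> 0" for a b :: real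
    using sum_squares_bound[of a b] mult_nonneg_nonneg[OF that] by linarith
  then show "AE z in bergman_measure \<alpha>. norm (f z * cnj (g z)) \<le> norm ((cmod (f z))\<^sup>2 + (cmod (g z))\<^sup>2)"
    by (simp add: norm_mult)
qed

lemma bergman_space_add:
  assumes f: "f \<in> bergman_space \<alpha>" and g: "g \<in> bergman_space \<alpha>"
  shows "(\<lambda>z. f z + g z) \<in> bergman_space \<alpha>"
proof -
  note [measurable] = bergman_space_measurable[OF f] bergman_space_measurable[OF g]
  have "integrable (bergman_measure \<alpha>) (\<lambda>z. (cmod (f z + g z))\<^sup>2)"
  proof (rule Bochner_Integration.integrable_bound)
    show "integrable (bergman_measure \<alpha>) (\<lambda>z. 2 * ((cmod (f z))\<^sup>2 + (cmod (g z))\<^sup>2))"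
      using f g by (simp add: bergman_space_def)
    have "(cmod (a + b))\<^sup>2 \<le> 2 * ((cmod a)\<^sup>2 + (cmod b)\<^sup>2)" for a b
    proof -
      have "(cmod (a + b))\<^sup>2 \<le> (cmod a + cmod b)\<^sup>2" by (intro power_mono norm_triangle_ineq) auto
      also have "\<dots> \<le> 2 * ((cmod a)\<^sup>2 + (cmod b)\<^sup>2)" 
        using sum_squares_bound[of "cmod a" "cmod b"] by (simp add: power2_sum)
      finally show ?thesis .
    qed
    then show "AE z in bergman_measure \<alpha>. norm ((cmod (f z + g z))\<^sup>2) \<le> norm (2 * ((cmod (f z))\<^sup>2 + (cmod (g z))\<^sup>2))"
      by simp
  qed measurable
  with f g show ?thesis by (auto simp: bergman_space_def intro: holomorphic_intros)
qed

lemma bergman_space_scale: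
  "f \<in> bergman_space \<alpha> \<Longrightarrow> (\<lambda>z. c * f z) \<in> bergman_space \<alpha>"
  by (auto simp: bergman_space_def norm_mult power_mult_distrib intro!: holomorphic_intros)

lemma bergman_space_zero: "(\<lambda>z. 0) \<in> bergman_space \<alpha>"
  by (simp add: bergman_space_def)

lemma bergman_space_diff:
  assumes "f \<in> bergman_space \<alpha>" "g \<in> bergman_space \<alpha>"
  shows "(\<lambda>z. f z - g z) \<in> bergman_space \<alpha>"
  using bergman_space_add[OF assms(1) bergman_space_scale[OF assms(2), of "-1"]] by simp

lemma bergman_space_sum:
  assumes "\<And>i. i \<in> I \<Longrightarrow> f i \<in> bergman_space \<alpha>"
  shows "(\<lambda>z. \<Sum>i\<in>I. f i z) \<in> bergman_space \<alpha>"
  using assms by (induction I rule: infinite_finite_induct) (auto intro: bergman_space_zero bergman_space_add)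

lemma finite_measure_bergman:
  assumes "\<alpha> > -1"
  shows "finite_measure (bergman_measure \<alpha>)"
  using nn_integral_norm_power[OF assms, of 0] by (intro finite_measureI) simp

lemma bergman_space_boundedI:
  assumes \<alpha>: "\<alpha> > -1" and hol: "f holomorphic_on unit_disc" and off: "\<And>z. z \<notin> unit_disc \<Longrightarrow> f z = 0"
    and bd: "\<And>z. z \<in> unit_disc \<Longrightarrow> cmod (f z) \<le> B"
  shows "f \<in> bergman_space \<alpha>"
proof -
  interpret finite_measure "bergman_measure \<alpha>" by (rule finite_measure_bergman[OF \<alpha>])
  have "(\<lambda>z. indicator unit_disc z *\<^sub>R f z) \<in> borel_measurable borel"
    using hol by (intro borel_measurable_continuous_on_indicator) 
      (auto intro: holomorphic_on_imp_continuous_on)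
  also have "(\<lambda>z. indicator unit_disc z *\<^sub>R f z) = f"
    using off by (auto simp: indicator_def fun_eq_iff)
  finally have [measurable]: "f \<in> borel_measurable borel" .
  have "integrable (bergman_measure \<alpha>) (\<lambda>z. (cmod (f z))\<^sup>2)"
  proof (rule integrable_const_bound[where B="B\<^sup>2"])
    have "(cmod (f z))\<^sup>2 \<le> B\<^sup>2" for z
    proof (cases "z \<in> unit_disc")
      case True
      then show ?thesis using bd by (intro power_mono) auto
    next
      case False
      then show ?thesis using off by simp
    qed
    then show "AE z in bergman_measure \<alpha>. norm ((cmod (f z))\<^sup>2) \<le> B\<^sup>2" by simp
  qed measurable
  with hol off show ?thesis by (simp add: bergman_space_def)
qed

lemma disc_monomial_in_space: "\<alpha> > -1 \<Longrightarrow> disc_monomial k \<in> bergman_space \<alpha>"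
proof (rule bergman_space_boundedI[where B=1])
  show "disc_monomial k holomorphic_on unit_disc"
    by (rule holomorphic_transform[of "\<lambda>z. z ^ k"]) (auto simp: disc_monomial_def intro!: holomorphic_intros)
qed (auto simp: disc_monomial_def norm_power power_le_one)

lemma taylor_sum_in_space: "\<alpha> > -1 \<Longrightarrow> taylor_sum f N \<in> bergman_space \<alpha>"
  unfolding taylor_sum_def[abs_def] by (intro bergman_space_sum bergman_space_scale disc_monomial_in_space)

lemma bergman_inner_commute: "bergman_inner \<alpha> g f = cnj (bergman_inner \<alpha> f g)"
  unfolding bergman_inner_def Bochner_Integration.integral_cnj[symmetric] by (simp add: mult.commute)

lemma bergman_inner_add_left:
  assumes "f \<in> bergman_space \<alpha>" "g \<in> bergman_space \<alpha>" "h \<in> bergman_space \<alpha>"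
  shows "bergman_inner \<alpha> (\<lambda>z. f z + g z) h = bergman_inner \<alpha> f h + bergman_inner \<alpha> g h"
  using assms by (simp add: bergman_inner_def distrib_right bergman_integrable_inner)

lemma bergman_inner_scale_left:
  "bergman_inner \<alpha> (\<lambda>z. c * f z) h = c * bergman_inner \<alpha> f h"
  by (simp add: bergman_inner_def mult.assoc)

lemma bergman_inner_diff_left:
  assumes "f \<in> bergman_space \<alpha>" "g \<in> bergman_space \<alpha>" "h \<in> bergman_space \<alpha>"
  shows "bergman_inner \<alpha> (\<lambda>z. f z - g z) h = bergman_inner \<alpha> f h - bergman_inner \<alpha> g h"
  using assms by (simp add: bergman_inner_def left_diff_distrib bergman_integrable_inner)

lemma bergman_inner_sum_left:
  assumes "\<And>i. i \<in> I \<Longrightarrow> f i \<in> bergman_space \<alpha>" "h \<in> bergman_space \<alpha>"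
  shows "bergman_inner \<alpha> (\<lambda>z. \<Sum>i\<in>I. f i z) h = (\<Sum>i\<in>I. bergman_inner \<alpha> (f i) h)"
  using assms by (simp add: bergman_inner_def sum_distrib_right bergman_integrable_inner)

lemma bergman_inner_scale_right:
  "bergman_inner \<alpha> f (\<lambda>z. c * h z) = cnj c * bergman_inner \<alpha> f h"
  using bergman_inner_scale_left[of \<alpha> c h f] by (metis bergman_inner_commute complex_cnj_mult)

lemma bergman_inner_diff_right:
  assumes "f \<in> bergman_space \<alpha>" "g \<in> bergman_space \<alpha>" "h \<in> bergman_space \<alpha>"
  shows "bergman_inner \<alpha> h (\<lambda>z. f z - g z) = bergman_inner \<alpha> h f - bergman_inner \<alpha> h g"
  using bergman_inner_diff_left[OF assms] by (metis bergman_inner_commute complex_cnj_diff)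

lemma bergman_inner_add_right:
  assumes "f \<in> bergman_space \<alpha>" "g \<in> bergman_space \<alpha>" "h \<in> bergman_space \<alpha>"
  shows "bergman_inner \<alpha> h (\<lambda>z. f z + g z) = bergman_inner \<alpha> h f + bergman_inner \<alpha> h g"
  using bergman_inner_add_left[OF assms] by (metis bergman_inner_commute complex_cnj_add)

lemma bergman_inner_sum_right:
  assumes "\<And>i. i \<in> I \<Longrightarrow> f i \<in> bergman_space \<alpha>" "h \<in> bergman_space \<alpha>"
  shows "bergman_inner \<alpha> h (\<lambda>z. \<Sum>i\<in>I. f i z) = (\<Sum>i\<in>I. bergman_inner \<alpha> h (f i))"
proof -
  have "bergman_inner \<alpha> h (\<lambda>z. \<Sum>i\<in>I. f i z) = cnj (\<Sum>i\<in>I. bergman_inner \<alpha> (f i) h)"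
    by (subst bergman_inner_commute) (simp add: bergman_inner_sum_left assms)
  also have "\<dots> = (\<Sum>i\<in>I. bergman_inner \<alpha> h (f i))"
    by (simp add: bergman_inner_commute[of \<alpha> h])
  finally show ?thesis .
qed

lemma bergman_norm_nonneg: "bergman_norm \<alpha> f \<ge> 0"
  by (simp add: bergman_norm_def integral_nonneg_AE)

lemma bergman_norm_squared: "(bergman_norm \<alpha> f)\<^sup>2 = (\<integral>z. (cmod (f z))\<^sup>2 \<partial>bergman_measure \<alpha>)"
  by (simp add: bergman_norm_def integral_nonneg_AE)

lemma bergman_inner_self: "bergman_inner \<alpha> f f = of_real ((bergman_norm \<alpha> f)\<^sup>2)"
  unfolding bergman_norm_squared bergman_inner_def integral_complex_of_real[symmetric]
  by (simp only: complex_norm_square)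

lemma bergman_norm_nn:
  assumes "f \<in> bergman_space \<alpha>"
  shows "(\<integral>\<^sup>+z. ennreal ((cmod (f z))\<^sup>2) \<partial>bergman_measure \<alpha>) = ennreal ((bergman_norm \<alpha> f)\<^sup>2)"
  unfolding bergman_norm_squared
  using assms by (intro nn_integral_eq_integral) (auto simp: bergman_space_def)

lemma bergman_Cauchy_Schwarz:
  assumes f: "f \<in> bergman_space \<alpha>" and g: "g \<in> bergman_space \<alpha>"
  shows "cmod (bergman_inner \<alpha> f g) \<le> bergman_norm \<alpha> f * bergman_norm \<alpha> g"
proof -
  note [measurable] = bergman_space_measurable[OF f] bergman_space_measurable[OF g]
  have "ennreal (cmod (bergman_inner \<alpha> f g)) \<le> (\<integral>\<^sup>+z. ennreal (cmod (f z * cnj (g z))) \<partial>bergman_measure \<alpha>)"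
    unfolding bergman_inner_def by (intro integral_norm_bound_ennreal bergman_integrable_inner f g)
  also have "\<dots> = (\<integral>\<^sup>+z. ennreal (cmod (f z)) * ennreal (cmod (g z)) \<partial>bergman_measure \<alpha>)"
    by (simp add: norm_mult ennreal_mult)
  finally have "(ennreal (cmod (bergman_inner \<alpha> f g)))\<^sup>2 \<le> (\<integral>\<^sup>+z. ennreal (cmod (f z)) * ennreal (cmod (g z)) \<partial>bergman_measure \<alpha>)\<^sup>2"
    by (intro power_mono) auto
  also have "\<dots> \<le> (\<integral>\<^sup>+z. (ennreal (cmod (f z)))\<^sup>2 \<partial>bergman_measure \<alpha>) * (\<integral>\<^sup>+z. (ennreal (cmod (g z)))\<^sup>2 \<partial>bergman_measure \<alpha>)"
    by (intro Cauchy_Schwarz_nn_integral) measurable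
  also have "\<dots> = ennreal ((bergman_norm \<alpha> f)\<^sup>2) * ennreal ((bergman_norm \<alpha> g)\<^sup>2)"
    by (simp add: ennreal_power bergman_norm_nn f g)
  finally have "(cmod (bergman_inner \<alpha> f g))\<^sup>2 \<le> (bergman_norm \<alpha> f * bergman_norm \<alpha> g)\<^sup>2"
    by (simp add: ennreal_power ennreal_mult[symmetric] power_mult_distrib)
  then show ?thesis
    by (rule power2_le_imp_le) (simp add: bergman_norm_nonneg)
qed

section \<open>Taylor coefficients and the inner product\<close>

text \<open>
  Under the rotation by \<open>pi / (j - k)\<close> the integrand changes its sign, while its integral does not
  change. The indicator of a smaller disc is radial, hence harmless; on such a disc Taylor series
  converge uniformly.
\<close>

lemma integral_monomials_orthogonal:
  assumes "j \<noteq> k"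
  shows "(\<integral>z. indicator (ball 0 r) z *\<^sub>R (z ^ j * cnj z ^ k) \<partial>bergman_measure \<alpha>) = 0"
    (is "?I = 0")
proof -
  let ?F = "\<lambda>z::complex. indicator (ball 0 r) z *\<^sub>R (z ^ j * cnj z ^ k)"
  define t where "t = pi / (real j - real k)"
  define u where "u = cis t"
  have u: "cmod u = 1" by (simp add: u_def)
  have m1: "u ^ j * cnj u ^ k = -1"
  proof -
    have "u ^ j * cnj u ^ k = cis (real j * t - real k * t)"
      by (simp add: u_def Complex.DeMoivre cis_cnj cis_mult)
    also have "real j * t - real k * t = pi"
      using assms by (simp add: t_def diff_divide_distrib[symmetric] left_diff_distrib[symmetric])
    finally show ?thesis by simp
  qed
  have "?I = (\<integral>z. ?F z \<partial>distr (bergman_measure \<alpha>) borel ((*) u))"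
    by (simp add: bergman_measure_rotate[OF u])
  also have "\<dots> = (\<integral>z. ?F (u * z) \<partial>bergman_measure \<alpha>)"
    by (subst integral_distr) auto
  also have "\<dots> = (\<integral>z. (u ^ j * cnj u ^ k) * ?F z \<partial>bergman_measure \<alpha>)"
    using u by (intro Bochner_Integration.integral_cong) (auto simp: norm_mult indicator_def power_mult_distrib)
  also have "\<dots> = - ?I" unfolding m1 by simp
  finally show ?thesis by simp
qed

lemma integral_norm_power:
  assumes "\<alpha> > -1"
  shows "integrable (bergman_measure \<alpha>) (\<lambda>z. cmod z ^ (2 * k))"
    and "(\<integral>z. cmod z ^ (2 * k) \<partial>bergman_measure \<alpha>) = bergman_moment \<alpha> k"
proof -
  show "integrable (bergman_measure \<alpha>) (\<lambda>z. cmod z ^ (2 * k))"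
    using nn_integral_norm_power[OF assms, of k] by (intro integrableI_nonneg) auto
  show "(\<integral>z. cmod z ^ (2 * k) \<partial>bergman_measure \<alpha>) = bergman_moment \<alpha> k"
    using nn_integral_norm_power[OF assms, of k] bergman_moment_pos[OF assms, of k]
    by (subst integral_eq_nn_integral) auto
qed

lemma power_mult_cnj: "z ^ k * cnj z ^ k = complex_of_real (cmod z ^ (2 * k))"
  by (simp add: power_mult_distrib[symmetric] complex_norm_square[symmetric] power_mult)

text \<open>
  On a disc of radius \<open>r < 1\<close> the Taylor series converges absolutely and uniformly, so that it can be
  integrated term by term, and orthogonality leaves a single term.
\<close>

lemma integral_small_disc_monomial:
  assumes \<alpha>: "\<alpha> > -1" and f: "f \<in> bergman_space \<alpha>" and r: "0 < r" "r < 1"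
  shows "(\<integral>z. indicator (ball 0 r) z *\<^sub>R (f z * cnj z ^ k) \<partial>bergman_measure \<alpha>) =
     taylor_coeff f k * of_real (\<integral>z. indicator (ball 0 r) z * cmod z ^ (2 * k) \<partial>bergman_measure \<alpha>)"
    (is "?L = taylor_coeff f k * of_real ?m")
proof -
  interpret finite_measure "bergman_measure \<alpha>" by (rule finite_measure_bergman[OF \<alpha>])
  note [measurable] = bergman_space_measurable[OF f]
  let ?a = "taylor_coeff f"
  let ?s = "\<lambda>N z. indicator (ball 0 r) z *\<^sub>R ((\<Sum>j<N. ?a j * z ^ j) * cnj z ^ k)"
  have sums: "(\<lambda>j. ?a j * z ^ j) sums f z" if "z \<in> unit_disc" for z
    using bergman_space_sums[OF f, of z] that by (simp add: disc_monomial_def)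
  \<comment> \<open>The series converges at a point of modulus strictly between \<open>r\<close> and 1, hence absolutely at \<open>r\<close>.\<close>
  have "summable (\<lambda>j. norm (?a j * of_real r ^ j))"
    by (rule powser_insidea[where x="of_real ((1 + r) / 2)"])
      (use r sums[of "of_real ((1 + r) / 2)"] in \<open>auto simp: sums_iff simp del: of_real_divide of_real_add\<close>)
  then have S: "summable (\<lambda>j. norm (?a j) * r ^ j)"
    using r by (simp add: norm_mult norm_power)
  define B where "B = (\<Sum>j. norm (?a j) * r ^ j)"
  have B0: "B \<ge> 0" unfolding B_def using r by (intro suminf_nonneg S) auto
  have mono_int: "integrable (bergman_measure \<alpha>) (\<lambda>z. indicator (ball 0 r) z *\<^sub>R (z ^ j * cnj z ^ k))" for j
  proof (rule integrable_const_bound[where B=1])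
    have "norm (indicator (ball 0 r) z *\<^sub>R (z ^ j * cnj z ^ k)) \<le> 1" for z :: complex
      using r by (auto simp: indicator_def norm_mult norm_power power_le_one intro!: mult_le_one)
    then show "AE z in bergman_measure \<alpha>. norm (indicator (ball 0 r) z *\<^sub>R (z ^ j * cnj z ^ k)) \<le> 1" by simp
  qed measurable
  have s_eq: "?s N z = (\<Sum>j<N. ?a j * (indicator (ball 0 r) z *\<^sub>R (z ^ j * cnj z ^ k)))" for N z
    by (simp add: sum_distrib_right scaleR_sum_right mult.assoc)
  have diag: "(\<integral>z. indicator (ball 0 r) z *\<^sub>R (z ^ k * cnj z ^ k) \<partial>bergman_measure \<alpha>) = of_real ?m"
    unfolding integral_complex_of_real[symmetric] power_mult_cnj by (simp add: scaleR_conv_of_real)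
  have int_s: "(\<integral>z. ?s N z \<partial>bergman_measure \<alpha>) = ?a k * of_real ?m" if "k < N" for N
  proof -
    have "(\<integral>z. ?s N z \<partial>bergman_measure \<alpha>) = (\<Sum>j<N. ?a j * (\<integral>z. indicator (ball 0 r) z *\<^sub>R (z ^ j * cnj z ^ k) \<partial>bergman_measure \<alpha>))"
      unfolding s_eq by (subst Bochner_Integration.integral_sum, intro integrable_mult_right mono_int)
        (simp only: integral_mult_right_zero)
    also have "\<dots> = (\<Sum>j<N. if j = k then ?a k * of_real ?m else 0)"
      by (intro sum.cong) (auto simp: diag integral_monomials_orthogonal)
    also have "\<dots> = ?a k * of_real ?m" using that by simp
    finally show ?thesis .
  qed
  have "(\<lambda>N. (\<integral>z. ?s N z \<partial>bergman_measure \<alpha>)) \<longlonglongrightarrow> ?L"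
  proof (rule integral_dominated_convergence[where w="\<lambda>_. B"])
    have "(\<lambda>N. ?s N z) \<longlonglongrightarrow> indicator (ball 0 r) z *\<^sub>R (f z * cnj z ^ k)" for z
    proof (cases "z \<in> ball 0 r")
      case True
      with r have "(\<lambda>N. \<Sum>j<N. ?a j * z ^ j) \<longlonglongrightarrow> f z" using sums[of z] by (simp add: sums_def)
      then show ?thesis by (intro tendsto_intros)
    qed simp
    then show "AE z in bergman_measure \<alpha>. (\<lambda>N. ?s N z) \<longlonglongrightarrow> indicator (ball 0 r) z *\<^sub>R (f z * cnj z ^ k)" by simp
    have "norm (?s N z) \<le> B" for N z
    proof (cases "z \<in> ball 0 r")
      case True
      then have z: "cmod z \<le> r" by simp
      have A: "norm (\<Sum>j<N. ?a j * z ^ j) \<le> (\<Sum>j<N. norm (?a j) * r ^ j)"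
        using z by (intro sum_norm_le) (auto simp: norm_mult norm_power intro!: mult_left_mono power_mono)
      have "norm (?s N z) = norm (\<Sum>j<N. ?a j * z ^ j) * cmod z ^ k"
        using True by (simp add: norm_mult norm_power)
      also have "\<dots> \<le> (\<Sum>j<N. norm (?a j) * r ^ j) * 1"
        using z r by (intro mult_mono A power_le_one sum_nonneg) auto
      also have "\<dots> \<le> B" unfolding B_def mult_1_right using r by (intro sum_le_suminf S) auto
      finally show ?thesis .
    qed (use B0 in simp)
    then show "AE z in bergman_measure \<alpha>. norm (?s N z) \<le> B" for N by simp
  qed (simp, measurable)
  moreover have "(\<lambda>N. (\<integral>z. ?s N z \<partial>bergman_measure \<alpha>)) \<longlonglongrightarrow> ?a k * of_real ?m"
    using int_s by (intro tendsto_eventually eventually_sequentiallyI[of "Suc k"]) auto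
  ultimately show ?thesis by (rule LIMSEQ_unique)
qed

text \<open>
  The limit \<open>r \<longlonglongrightarrow> 1\<close> of the preceding lemma. Term-by-term integration is not available on the full
  disc, where the partial sums need not be dominated.
\<close>

lemma bergman_inner_monomial:
  assumes \<alpha>: "\<alpha> > -1" and f: "f \<in> bergman_space \<alpha>"
  shows "bergman_inner \<alpha> f (disc_monomial k) = taylor_coeff f k * of_real (bergman_moment \<alpha> k)"
proof -
  note [measurable] = bergman_space_measurable[OF f] bergman_space_measurable[OF disc_monomial_in_space[OF \<alpha>]]
  define r where "r m = 1 - 1 / (real m + 2)" for m
  have r: "0 < r m" "r m < 1" for m by (auto simp: r_def field_simps)
  have r_lim: "r \<longlonglongrightarrow> 1"
    unfolding r_def by real_asymp
  have ind: "\<forall>\<^sub>F m in sequentially. indicator (ball 0 (r m)) z = (1::real)" if "z \<in> unit_disc" for z :: complex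
    proof -
    have "\<forall>\<^sub>F m in sequentially. cmod z < r m" using that by (intro order_tendstoD(1)[OF r_lim]) simp
    then show ?thesis by eventually_elim (simp add: indicator_def)
  qed
  have "(\<lambda>m. \<integral>z. indicator (ball 0 (r m)) z *\<^sub>R (f z * cnj z ^ k) \<partial>bergman_measure \<alpha>) \<longlonglongrightarrow> bergman_inner \<alpha> f (disc_monomial k)"
    unfolding bergman_inner_def
  proof (rule integral_dominated_convergence[where w="\<lambda>z. norm (f z * cnj (disc_monomial k z))"])
    show "integrable (bergman_measure \<alpha>) (\<lambda>z. norm (f z * cnj (disc_monomial k z)))"
      by (intro integrable_norm bergman_integrable_inner f disc_monomial_in_space \<alpha>)
    show "AE z in bergman_measure \<alpha>. (\<lambda>m. indicator (ball 0 (r m)) z *\<^sub>R (f z * cnj z ^ k)) \<longlonglongrightarrow> f z * cnj (disc_monomial k z)"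
      using AE_bergman_unit_disc
    proof eventually_elim
      case (elim z)
      show ?case
        by (rule tendsto_eventually, rule eventually_mono[OF ind[OF elim]]) (use elim in \<open>simp add: disc_monomial_def\<close>)
    qed
    show "AE z in bergman_measure \<alpha>. norm (indicator (ball 0 (r m)) z *\<^sub>R (f z * cnj z ^ k)) \<le> norm (f z * cnj (disc_monomial k z))" for m
      using AE_bergman_unit_disc by eventually_elim (auto simp: disc_monomial_def indicator_def)
  qed measurable
  moreover have "(\<lambda>m. taylor_coeff f k * of_real (\<integral>z. indicator (ball 0 (r m)) z * cmod z ^ (2 * k) \<partial>bergman_measure \<alpha>))
      \<longlonglongrightarrow> taylor_coeff f k * of_real (\<integral>z. cmod z ^ (2 * k) \<partial>bergman_measure \<alpha>)"
  proof (intro tendsto_intros integral_dominated_convergence[where w="\<lambda>z. cmod z ^ (2 * k)"])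
    show "AE z in bergman_measure \<alpha>. (\<lambda>m. indicator (ball 0 (r m)) z * cmod z ^ (2 * k)) \<longlonglongrightarrow> cmod z ^ (2 * k)"
      using AE_bergman_unit_disc
    proof eventually_elim
      case (elim z)
      show ?case
        by (rule tendsto_eventually, rule eventually_mono[OF ind[OF elim]]) simp
    qed
  qed (auto simp: indicator_def integral_norm_power \<alpha>)
  ultimately show ?thesis
    unfolding integral_small_disc_monomial[OF \<alpha> f r] integral_norm_power(2)[OF \<alpha>]
    by (rule LIMSEQ_unique)
qed

lemma bergman_inner_taylor_sum:
  assumes \<alpha>: "\<alpha> > -1" and f: "f \<in> bergman_space \<alpha>"
  shows "bergman_inner \<alpha> f (taylor_sum g N) = (\<Sum>k<N. taylor_coeff f k * cnj (taylor_coeff g k) * of_real (bergman_moment \<alpha> k))"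
  unfolding taylor_sum_def[abs_def]
  by (subst bergman_inner_sum_right)
    (auto intro!: sum.cong bergman_space_scale disc_monomial_in_space \<alpha> f simp: bergman_inner_scale_right bergman_inner_monomial \<alpha> f)

lemma taylor_coeff_taylor_sum: "taylor_coeff (taylor_sum g N) k = (if k < N then taylor_coeff g k else 0)"
proof (rule taylor_coeff_unique)
  fix z assume "z \<in> unit_disc"
  then show "(\<lambda>k. (if k < N then taylor_coeff g k else 0) * z ^ k) sums taylor_sum g N z"
    using sums_If_finite_set[of "{..<N}" "\<lambda>k. taylor_coeff g k * z ^ k"]
    by (simp add: taylor_sum_def disc_monomial_def if_distrib[of "\<lambda>x. x * _"] cong: if_cong)
qed

lemma bergman_norm_taylor_sum:
  assumes \<alpha>: "\<alpha> > -1"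
  shows "(bergman_norm \<alpha> (taylor_sum g N))\<^sup>2 = (\<Sum>k<N. (cmod (taylor_coeff g k))\<^sup>2 * bergman_moment \<alpha> k)"
proof -
  have "complex_of_real ((bergman_norm \<alpha> (taylor_sum g N))\<^sup>2) = of_real (\<Sum>k<N. (cmod (taylor_coeff g k))\<^sup>2 * bergman_moment \<alpha> k)"
    unfolding bergman_inner_self[symmetric] bergman_inner_taylor_sum[OF \<alpha> taylor_sum_in_space[OF \<alpha>]] of_real_sum of_real_mult complex_norm_square
    by (intro sum.cong) (auto simp: taylor_coeff_taylor_sum)
  then show ?thesis by (simp only: of_real_eq_iff)
qed

lemma bergman_norm_diff_taylor_sum:
  assumes \<alpha>: "\<alpha> > -1" and g: "g \<in> bergman_space \<alpha>"
  shows "(bergman_norm \<alpha> (\<lambda>z. g z - taylor_sum g N z))\<^sup>2 =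
     (bergman_norm \<alpha> g)\<^sup>2 - (\<Sum>k<N. (cmod (taylor_coeff g k))\<^sup>2 * bergman_moment \<alpha> k)" (is "?l = _ - ?S")
proof -
  let ?p = "taylor_sum g N"
  note p = taylor_sum_in_space[OF \<alpha>, of g N]
  have S: "bergman_inner \<alpha> g ?p = of_real ?S"
    unfolding bergman_inner_taylor_sum[OF \<alpha> g] of_real_sum of_real_mult complex_norm_square ..
  have "complex_of_real ?l = bergman_inner \<alpha> g g - bergman_inner \<alpha> ?p g - (bergman_inner \<alpha> g ?p - bergman_inner \<alpha> ?p ?p)"
    unfolding bergman_inner_self[symmetric]
    by (simp add: bergman_inner_diff_left bergman_inner_diff_right bergman_space_diff g p)
  also have "bergman_inner \<alpha> ?p g = of_real ?S"
    by (subst bergman_inner_commute) (simp only: S complex_cnj_complex_of_real)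
  finally have "complex_of_real ?l = of_real ((bergman_norm \<alpha> g)\<^sup>2 - ?S)"
    unfolding S bergman_inner_self bergman_norm_taylor_sum[OF \<alpha>] by simp
  then show ?thesis by (simp only: of_real_eq_iff)
qed

text \<open>
  By orthogonality the square of the error is the difference between the squared norm of \<open>g\<close> and a
  partial sum of \<open>\<Sum>k. |a k|\<^sup>2 * bergman_moment \<alpha> k\<close>. Hence the claim is Parseval's identity. One inequality
  (Bessel) holds because the error is nonnegative; the other one is Fatou's lemma, applied to the
  pointwise convergent Taylor sums.
\<close>

lemma bergman_taylor_sum_tendsto:
  assumes \<alpha>: "\<alpha> > -1" and g: "g \<in> bergman_space \<alpha>"
  shows "(\<lambda>N. bergman_norm \<alpha> (\<lambda>z. g z - taylor_sum g N z)) \<longlonglongrightarrow> 0"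
proof -
  note [measurable] = bergman_space_measurable[OF g] bergman_space_measurable[OF taylor_sum_in_space[OF \<alpha>]]
  define S where "S N = (\<Sum>k<N. (cmod (taylor_coeff g k))\<^sup>2 * bergman_moment \<alpha> k)" for N
  have S0: "S N \<ge> 0" for N
    unfolding S_def using bergman_moment_pos[OF \<alpha>] by (intro sum_nonneg mult_nonneg_nonneg) (auto intro: less_imp_le)
  have Sle: "S N \<le> (bergman_norm \<alpha> g)\<^sup>2" for N
    using bergman_norm_diff_taylor_sum[OF \<alpha> g, of N] zero_le_power2[of "bergman_norm \<alpha> (\<lambda>z. g z - taylor_sum g N z)"]
    unfolding S_def by linarith
  \<comment> \<open>Bessel's inequality makes the partial sums converge; Fatou's lemma identifies their limit.\<close>
  have "incseq S"
    unfolding S_def using bergman_moment_pos[OF \<alpha>]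
    by (intro incseq_SucI) (auto intro!: mult_nonneg_nonneg intro: less_imp_le)
  then obtain L where L: "S \<longlonglongrightarrow> L" using incseq_convergent[OF _ , of S] Sle by blast
  have "ennreal ((bergman_norm \<alpha> g)\<^sup>2) = (\<integral>\<^sup>+z. liminf (\<lambda>N. ennreal ((cmod (taylor_sum g N z))\<^sup>2)) \<partial>bergman_measure \<alpha>)"
    unfolding bergman_norm_nn[OF g, symmetric]
  proof (rule nn_integral_cong)
    fix z
    have "(\<lambda>N. taylor_sum g N z) \<longlonglongrightarrow> g z"
      using bergman_space_sums[OF g, of z] by (simp add: sums_def taylor_sum_def)
    then have "(\<lambda>N. ennreal ((cmod (taylor_sum g N z))\<^sup>2)) \<longlonglongrightarrow> ennreal ((cmod (g z))\<^sup>2)"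
      by (intro tendsto_intros)
    then show "ennreal ((cmod (g z))\<^sup>2) = liminf (\<lambda>N. ennreal ((cmod (taylor_sum g N z))\<^sup>2))"
      by (intro lim_imp_Liminf[symmetric]) auto
  qed
  also have "\<dots> \<le> liminf (\<lambda>N. \<integral>\<^sup>+z. ennreal ((cmod (taylor_sum g N z))\<^sup>2) \<partial>bergman_measure \<alpha>)"
    by (rule nn_integral_liminf) measurable
  also have "\<dots> = liminf (\<lambda>N. ennreal (S N))"
    unfolding bergman_norm_nn[OF taylor_sum_in_space[OF \<alpha>]] bergman_norm_taylor_sum[OF \<alpha>] S_def ..
  also have "\<dots> = ennreal L"
    using L by (intro lim_imp_Liminf tendsto_intros) auto
  finally have "(bergman_norm \<alpha> g)\<^sup>2 \<le> L"
    using LIMSEQ_le_const[OF L, of 0] S0 by (simp add: ennreal_le_iff)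
  moreover have "L \<le> (bergman_norm \<alpha> g)\<^sup>2" using LIMSEQ_le_const2[OF L] Sle by blast
  ultimately have "S \<longlonglongrightarrow> (bergman_norm \<alpha> g)\<^sup>2" using L by simp
  then have "(\<lambda>N. (bergman_norm \<alpha> g)\<^sup>2 - S N) \<longlonglongrightarrow> (bergman_norm \<alpha> g)\<^sup>2 - (bergman_norm \<alpha> g)\<^sup>2"
    by (intro tendsto_intros)
  then have "(\<lambda>N. (bergman_norm \<alpha> (\<lambda>z. g z - taylor_sum g N z))\<^sup>2) \<longlonglongrightarrow> 0"
    unfolding bergman_norm_diff_taylor_sum[OF \<alpha> g] S_def by simp
  then show ?thesis by (simp add: power_tendsto_0_iff)
qed

lemma bergman_inner_tendsto_right:
  assumes f: "f \<in> bergman_space \<alpha>" and h: "\<And>N. h N \<in> bergman_space \<alpha>"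
    and lim: "(\<lambda>N. bergman_norm \<alpha> (h N)) \<longlonglongrightarrow> 0"
  shows "(\<lambda>N. bergman_inner \<alpha> f (h N)) \<longlonglongrightarrow> 0"
proof (rule Lim_null_comparison)
  show "\<forall>\<^sub>F N in sequentially. norm (bergman_inner \<alpha> f (h N)) \<le> bergman_norm \<alpha> f * bergman_norm \<alpha> (h N)"
    by (intro always_eventually allI bergman_Cauchy_Schwarz f h)
  show "(\<lambda>N. bergman_norm \<alpha> f * bergman_norm \<alpha> (h N)) \<longlonglongrightarrow> 0"
    using tendsto_mult_left[OF lim, of "bergman_norm \<alpha> f"] by simp
qed

lemma bergman_inner_sums:
  assumes \<alpha>: "\<alpha> > -1" and f: "f \<in> bergman_space \<alpha>" and g: "g \<in> bergman_space \<alpha>"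
  shows "(\<lambda>k. taylor_coeff f k * cnj (taylor_coeff g k) * of_real (bergman_moment \<alpha> k)) sums bergman_inner \<alpha> f g"
proof -
  have "(\<lambda>N. bergman_inner \<alpha> f (\<lambda>z. g z - taylor_sum g N z)) \<longlonglongrightarrow> 0"
    by (intro bergman_inner_tendsto_right bergman_taylor_sum_tendsto bergman_space_diff taylor_sum_in_space \<alpha> f g)
  then have "(\<lambda>N. bergman_inner \<alpha> f g - bergman_inner \<alpha> f (taylor_sum g N)) \<longlonglongrightarrow> 0"
    by (simp add: bergman_inner_diff_right f g taylor_sum_in_space \<alpha>)
  then have "(\<lambda>N. bergman_inner \<alpha> f (taylor_sum g N)) \<longlonglongrightarrow> bergman_inner \<alpha> f g"
    using tendsto_diff[OF tendsto_const[of "bergman_inner \<alpha> f g"]] by fastforce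
  then show ?thesis unfolding sums_def bergman_inner_taylor_sum[OF \<alpha> f] .
qed

section \<open>Reproducing kernels\<close>

text \<open>
  For \<open>n = 0\<close> this is the reproducing kernel at \<open>w\<close>; for general \<open>n\<close> it is its \<open>n\<close>-th derivative with respect
  to \<open>cnj w\<close>, and it represents the functional \<open>f \<mapsto> (deriv ^^ n) f w\<close>.
\<close>

definition bergman_kernel :: "real \<Rightarrow> nat \<Rightarrow> complex \<Rightarrow> complex \<Rightarrow> complex" where
  "bergman_kernel \<alpha> n w z =
     (if z \<in> unit_disc
      then of_real (pochhammer (\<alpha> + 2) n) * z ^ n / (1 - cnj w * z) powr of_real (real n + \<alpha> + 2)
      else 0)"

lemma Re_one_minus_pos:
  assumes "cmod w < 1" "cmod z \<le> 1"
  shows "0 < Re (1 - cnj w * z)"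
proof -
  have "Re (cnj w * z) \<le> cmod w * cmod z"
    using complex_Re_le_cmod[of "cnj w * z"] by (simp add: norm_mult)
  also have "\<dots> \<le> cmod w * 1" using assms by (intro mult_left_mono) auto
  finally show ?thesis using assms by simp
qed

lemma one_minus_notin_nonpos:
  assumes "cmod w < 1" "cmod z \<le> 1"
  shows "1 - cnj w * z \<notin> \<real>\<^sub>\<le>\<^sub>0"
  using Re_one_minus_pos[OF assms] by (auto simp: complex_nonpos_Reals_iff)

lemma cnj_mult_neq_1:
  assumes "cmod w < 1" "cmod z \<le> 1"
  shows "cnj w * z \<noteq> 1"
  using one_minus_notin_nonpos[OF assms] by auto

lemma bergman_kernel_in_space:
  assumes \<alpha>: "\<alpha> > -1" and w: "w \<in> unit_disc"
  shows "bergman_kernel \<alpha> n w \<in> bergman_space \<alpha>"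
proof -
  let ?k = "\<lambda>z. of_real (pochhammer (\<alpha> + 2) n) * z ^ n / (1 - cnj w * z) powr of_real (real n + \<alpha> + 2)"
  have nz: "1 - cnj w * z \<notin> \<real>\<^sub>\<le>\<^sub>0" "1 - cnj w * z \<noteq> 0" if "cmod z \<le> 1" for z
    using one_minus_notin_nonpos[of w z] w that by auto
  have "continuous_on (cball 0 1) ?k"
    using nz by (intro holomorphic_on_imp_continuous_on holomorphic_intros) auto
  then have "bounded (?k ` cball 0 1)"
    by (intro compact_imp_bounded compact_continuous_image) auto
  then obtain B where B: "\<forall>z\<in>cball 0 1. cmod (?k z) \<le> B"
    unfolding bounded_iff by blast
  show ?thesis
  proof (rule bergman_space_boundedI[OF \<alpha>])
    have "?k holomorphic_on unit_disc"
      using nz by (intro holomorphic_intros) auto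
    then show "bergman_kernel \<alpha> n w holomorphic_on unit_disc"
      by (rule holomorphic_transform) (simp add: bergman_kernel_def)
    show "cmod (bergman_kernel \<alpha> n w z) \<le> B" if "z \<in> unit_disc" for z
      using B that by (simp add: bergman_kernel_def)
  qed (simp add: bergman_kernel_def)
qed

lemma one_minus_powr_sums:
  assumes "cmod x < 1"
  shows "(\<lambda>m. pochhammer s m / fact m * x ^ m) sums (1 - x) powr (- s)"
proof -
  have "((- s) gchoose m) * (- x) ^ m = pochhammer s m / fact m * x ^ m" for m
    by (simp add: gbinomial_pochhammer power_minus[of x])
  then show ?thesis
    using gen_binomial_complex[of "- x" "- s"] assms by simp
qed

text \<open>
  The binomial series, together with \<open>pochhammer (\<alpha> + 2) k = fact k / bergman_moment \<alpha> k\<close>.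
\<close>

lemma taylor_coeff_kernel:
  assumes \<alpha>: "\<alpha> > -1" and w: "w \<in> unit_disc"
  shows "taylor_coeff (bergman_kernel \<alpha> n w) k =
     (if k < n then 0 else of_real (fact k / (fact (k - n) * bergman_moment \<alpha> k)) * cnj w ^ (k - n))"
proof (rule taylor_coeff_unique)
  fix z assume z: "z \<in> unit_disc"
  let ?c = "\<lambda>k. if k < n then 0 else of_real (fact k / (fact (k - n) * bergman_moment \<alpha> k)) * cnj w ^ (k - n)"
  let ?s = "complex_of_real (real n + \<alpha> + 2)"
  let ?p = "complex_of_real (pochhammer (\<alpha> + 2) n)"
  have "cmod (cnj w * z) < 1"
    using w z norm_mult_less[of "cnj w" 1 z 1] by simp
  from sums_mult[OF one_minus_powr_sums[OF this, of ?s], of "?p * z ^ n"]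
  have "(\<lambda>m. ?p * z ^ n * (pochhammer ?s m / fact m * (cnj w * z) ^ m)) sums bergman_kernel \<alpha> n w z"
    using z by (simp only: bergman_kernel_def powr_minus divide_inverse if_True)
  also have "(\<lambda>m. ?p * z ^ n * (pochhammer ?s m / fact m * (cnj w * z) ^ m)) = (\<lambda>m. ?c (m + n) * z ^ (m + n))"
  proof
    fix m
    have "pochhammer (\<alpha> + 2) n * pochhammer (real n + \<alpha> + 2) m = pochhammer (\<alpha> + 2) (m + n)"
      using pochhammer_product[of n "m + n" "\<alpha> + 2"] by (simp add: add_ac)
    then have "?p * pochhammer ?s m = of_real (pochhammer (\<alpha> + 2) (m + n))"
      by (simp only: pochhammer_of_real of_real_mult[symmetric])
    moreover have "fact (m + n) / bergman_moment \<alpha> (m + n) = pochhammer (\<alpha> + 2) (m + n)"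
      by (simp add: bergman_moment_def)
    ultimately have "?p * pochhammer ?s m = of_real (fact (m + n) / bergman_moment \<alpha> (m + n))" by simp
    then have c: "?p * pochhammer ?s m / fact m = of_real (fact (m + n) / (fact m * bergman_moment \<alpha> (m + n)))"
      by (simp add: field_simps)
    have "?p * z ^ n * (pochhammer ?s m / fact m * (cnj w * z) ^ m) =
        (?p * pochhammer ?s m / fact m) * cnj w ^ m * z ^ (m + n)"
      by (simp add: power_add power_mult_distrib)
    also have "\<dots> = ?c (m + n) * z ^ (m + n)" unfolding c by simp
    finally show "?p * z ^ n * (pochhammer ?s m / fact m * (cnj w * z) ^ m) = ?c (m + n) * z ^ (m + n)" .
  qed
  finally show "(\<lambda>k. ?c k * z ^ k) sums bergman_kernel \<alpha> n w z"
    by (subst (asm) sums_zero_iff_shift) auto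
qed

text \<open>
  In the series for the inner product the moments cancel against those in the coefficients of the
  kernel. What remains is the \<open>n\<close> times differentiated Taylor series of \<open>f\<close> at \<open>w\<close>.
\<close>

lemma bergman_reproducing:
  assumes \<alpha>: "\<alpha> > -1" and w: "w \<in> unit_disc" and f: "f \<in> bergman_space \<alpha>"
  shows "bergman_inner \<alpha> f (bergman_kernel \<alpha> n w) = (deriv ^^ n) f w"
proof -
  have hol: "f holomorphic_on ball 0 1" using f by (simp add: bergman_space_def)
  let ?t = "\<lambda>k. taylor_coeff f k * cnj (taylor_coeff (bergman_kernel \<alpha> n w) k) * of_real (bergman_moment \<alpha> k)"
  have "(\<lambda>m. (deriv ^^ m) ((deriv ^^ n) f) 0 / fact m * (w - 0) ^ m) sums (deriv ^^ n) f w"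
    using w by (intro holomorphic_power_series[where r=1] holomorphic_higher_deriv hol) auto
  also have "(\<lambda>m. (deriv ^^ m) ((deriv ^^ n) f) 0 / fact m * (w - 0) ^ m) = (\<lambda>m. ?t (m + n))"
  proof
    fix m
    have "?t (m + n) = (deriv ^^ (m + n)) f 0 / fact (m + n) *
        cnj (of_real (fact (m + n) / (fact m * bergman_moment \<alpha> (m + n))) * cnj w ^ m) * of_real (bergman_moment \<alpha> (m + n))"
      by (simp only: taylor_coeff_kernel[OF \<alpha> w]) (simp add: taylor_coeff_def)
    also have "\<dots> = (deriv ^^ (m + n)) f 0 / fact m * w ^ m"
      using bergman_moment_pos[OF \<alpha>, of "m + n"] by (simp add: field_simps)
    finally show "(deriv ^^ m) ((deriv ^^ n) f) 0 / fact m * (w - 0) ^ m = ?t (m + n)"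
      by (simp add: funpow_add)
  qed
  finally have "?t sums (deriv ^^ n) f w"
    by (subst (asm) sums_zero_iff_shift) (auto simp: taylor_coeff_kernel[OF \<alpha> w])
  moreover have "?t sums bergman_inner \<alpha> f (bergman_kernel \<alpha> n w)"
    by (intro bergman_inner_sums bergman_kernel_in_space \<alpha> w f)
  ultimately show ?thesis by (rule sums_unique2[symmetric])
qed

text \<open>
  Both sides are the inner product of two kernels, read in the two possible orders.
\<close>

lemma higher_deriv_kernel_symmetric:
  assumes \<alpha>: "\<alpha> > -1" and w: "w \<in> unit_disc" and u: "u \<in> unit_disc"
  shows "(deriv ^^ n) (bergman_kernel \<alpha> 0 w) u = cnj (bergman_kernel \<alpha> n u w)"
proof -
  have "(deriv ^^ n) (bergman_kernel \<alpha> 0 w) u = bergman_inner \<alpha> (bergman_kernel \<alpha> 0 w) (bergman_kernel \<alpha> n u)"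
    by (intro bergman_reproducing[symmetric] bergman_kernel_in_space \<alpha> w u)
  also have "\<dots> = cnj (bergman_inner \<alpha> (bergman_kernel \<alpha> n u) (bergman_kernel \<alpha> 0 w))"
    by (rule bergman_inner_commute)
  also have "bergman_inner \<alpha> (bergman_kernel \<alpha> n u) (bergman_kernel \<alpha> 0 w) = bergman_kernel \<alpha> n u w"
    using bergman_reproducing[of \<alpha> w "bergman_kernel \<alpha> n u" 0] bergman_kernel_in_space[OF \<alpha> u] \<alpha> w by simp
  finally show ?thesis .
qed

section \<open>Adjoints and Hermitian operators\<close>

lemma bergman_adjoint_eqI:
  assumes \<alpha>: "\<alpha> > -1" and h: "h \<in> bergman_space \<alpha>"
    and eq: "\<And>f. f \<in> bergman_space \<alpha> \<Longrightarrow> bergman_inner \<alpha> (T f) g = bergman_inner \<alpha> f h"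
  shows "bergman_adjoint \<alpha> T g = h"
  unfolding bergman_adjoint_def
proof (rule the_equality)
  fix h' assume h': "h' \<in> bergman_space \<alpha> \<and> (\<forall>f\<in>bergman_space \<alpha>. bergman_inner \<alpha> (T f) g = bergman_inner \<alpha> f h')"
  show "h' = h"
  proof (rule bergman_space_eqI[OF _ h])
    fix k
    have "bergman_inner \<alpha> h' (disc_monomial k) = bergman_inner \<alpha> h (disc_monomial k)"
      using h' eq disc_monomial_in_space[OF \<alpha>, of k] by (simp add: bergman_inner_commute[of \<alpha> _ "disc_monomial k"])
    then show "taylor_coeff h' k = taylor_coeff h k"
      using h h' bergman_moment_pos[OF \<alpha>, of k] by (simp add: bergman_inner_monomial[OF \<alpha>])
  qed (use h' in simp)
qed (use h eq in auto)

text \<open>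
  Testing \<open>T f\<close> against the kernel at \<open>w\<close> evaluates \<open>T f\<close> at \<open>w\<close>, which is \<open>\<psi> w\<close> times the \<open>n\<close>-th derivative
  of \<open>f\<close> at \<open>\<phi> w\<close>; that derivative is again an inner product with a kernel.
\<close>

lemma bergman_adjoint_kernel:
  assumes \<alpha>: "\<alpha> > -1" and w: "w \<in> unit_disc" and \<phi>w: "\<phi> w \<in> unit_disc"
    and bdd: "bergman_bounded_operator \<alpha> (weighted_comp_diff n \<psi> \<phi>)"
  shows "bergman_adjoint \<alpha> (weighted_comp_diff n \<psi> \<phi>) (bergman_kernel \<alpha> 0 w) =
    (\<lambda>z. cnj (\<psi> w) * bergman_kernel \<alpha> n (\<phi> w) z)"
proof (rule bergman_adjoint_eqI[OF \<alpha>])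
  show "(\<lambda>z. cnj (\<psi> w) * bergman_kernel \<alpha> n (\<phi> w) z) \<in> bergman_space \<alpha>"
    by (intro bergman_space_scale bergman_kernel_in_space \<alpha> \<phi>w)
  fix f assume f: "f \<in> bergman_space \<alpha>"
  then have "weighted_comp_diff n \<psi> \<phi> f \<in> bergman_space \<alpha>"
    using bdd by (simp add: bergman_bounded_operator_def)
  from bergman_reproducing[OF \<alpha> w this, of 0]
  show "bergman_inner \<alpha> (weighted_comp_diff n \<psi> \<phi> f) (bergman_kernel \<alpha> 0 w) =
      bergman_inner \<alpha> f (\<lambda>z. cnj (\<psi> w) * bergman_kernel \<alpha> n (\<phi> w) z)"
    using w by (simp add: bergman_inner_scale_right bergman_reproducing[OF \<alpha> \<phi>w f] weighted_comp_diff_def)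
qed

lemma bergman_bounded_operator_taylor_sum:
  assumes \<alpha>: "\<alpha> > -1" and bdd: "bergman_bounded_operator \<alpha> T"
  shows "T (taylor_sum g N) = (\<lambda>z. \<Sum>k<N. taylor_coeff g k * T (disc_monomial k) z)"
proof (induction N)
  case 0
  have "\<forall>f\<in>bergman_space \<alpha>. \<forall>k. T (\<lambda>z. k * f z) = (\<lambda>z. k * T f z)"
    using bdd unfolding bergman_bounded_operator_def by blast
  from this[rule_format, OF bergman_space_zero, of 0] show ?case by (simp add: taylor_sum_def[abs_def])
next
  case (Suc N)
  have add: "\<forall>f\<in>bergman_space \<alpha>. \<forall>g\<in>bergman_space \<alpha>. T (\<lambda>z. f z + g z) = (\<lambda>z. T f z + T g z)"
    using bdd unfolding bergman_bounded_operator_def by blast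
  have "taylor_sum g (Suc N) = (\<lambda>z. taylor_sum g N z + taylor_coeff g N * disc_monomial N z)"
    by (simp add: taylor_sum_def fun_eq_iff)
  then have "T (taylor_sum g (Suc N)) = T (\<lambda>z. taylor_sum g N z + taylor_coeff g N * disc_monomial N z)"
    by (rule arg_cong)
  also have "\<dots> = (\<lambda>z. T (taylor_sum g N) z + T (\<lambda>z. taylor_coeff g N * disc_monomial N z) z)"
    by (rule add[rule_format, OF taylor_sum_in_space[OF \<alpha>] bergman_space_scale[OF disc_monomial_in_space[OF \<alpha>]]])
  also have "T (\<lambda>z. taylor_coeff g N * disc_monomial N z) = (\<lambda>z. taylor_coeff g N * T (disc_monomial N) z)"
    using bdd disc_monomial_in_space[OF \<alpha>, of N] unfolding bergman_bounded_operator_def by blast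
  finally show ?case by (simp add: Suc.IH)
qed

text \<open>
  The kernels span a dense subspace, in the following sense. For fixed \<open>f\<close> the
  defect \<open>L g\<close>, which is the difference of the inner products of \<open>T f\<close> with \<open>g\<close> and of \<open>f\<close> with \<open>T g\<close>, is
  conjugate linear and continuous in \<open>g\<close>, so it is determined through the Taylor coefficients of \<open>g\<close> by
  its values on monomials. On the kernel at \<open>w\<close> it becomes a power series in \<open>w\<close>, whose coefficients are
  these values up to positive factors. As this power series vanishes on the disc, so does \<open>L\<close> on all
  monomials, and hence everywhere.
\<close>

lemma bergman_hermitianI_kernel:
  assumes \<alpha>: "\<alpha> > -1" and bdd: "bergman_bounded_operator \<alpha> T"
    and ker: "\<And>f w. f \<in> bergman_space \<alpha> \<Longrightarrow> w \<in> unit_disc \<Longrightarrow>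
       bergman_inner \<alpha> (T f) (bergman_kernel \<alpha> 0 w) = bergman_inner \<alpha> f (T (bergman_kernel \<alpha> 0 w))"
  shows "bergman_hermitian \<alpha> T"
  unfolding bergman_hermitian_def
proof (intro ballI sym[OF bergman_adjoint_eqI[OF \<alpha>]])
  have T: "T f \<in> bergman_space \<alpha>" if "f \<in> bergman_space \<alpha>" for f
    using bdd that by (simp add: bergman_bounded_operator_def)
  have add: "\<forall>f\<in>bergman_space \<alpha>. \<forall>g\<in>bergman_space \<alpha>. T (\<lambda>z. f z + g z) = (\<lambda>z. T f z + T g z)"
    using bdd unfolding bergman_bounded_operator_def by blast
  obtain C where C: "\<forall>f\<in>bergman_space \<alpha>. bergman_norm \<alpha> (T f) \<le> C * bergman_norm \<alpha> f"
    using bdd unfolding bergman_bounded_operator_def by blast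
  fix g assume g: "g \<in> bergman_space \<alpha>"
  show "T g \<in> bergman_space \<alpha>" by (rule T[OF g])
  fix f assume f: "f \<in> bergman_space \<alpha>"
  define L where "L h = bergman_inner \<alpha> (T f) h - bergman_inner \<alpha> f (T h)" for h
  note e = disc_monomial_in_space[OF \<alpha>] and p = taylor_sum_in_space[OF \<alpha>]
  have L_poly: "L (taylor_sum h N) = (\<Sum>k<N. cnj (taylor_coeff h k) * L (disc_monomial k))" for h N
  proof -
    have "bergman_inner \<alpha> (T f) (taylor_sum h N) = (\<Sum>k<N. cnj (taylor_coeff h k) * bergman_inner \<alpha> (T f) (disc_monomial k))"
      unfolding taylor_sum_def[abs_def]
      by (subst bergman_inner_sum_right) (auto simp: bergman_inner_scale_right intro!: bergman_space_scale e T f)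
    moreover have "bergman_inner \<alpha> f (T (taylor_sum h N)) = (\<Sum>k<N. cnj (taylor_coeff h k) * bergman_inner \<alpha> f (T (disc_monomial k)))"
      unfolding bergman_bounded_operator_taylor_sum[OF \<alpha> bdd]
      by (subst bergman_inner_sum_right) (auto simp: bergman_inner_scale_right intro!: bergman_space_scale e T f)
    ultimately show ?thesis by (simp add: L_def sum_subtractf right_diff_distrib)
  qed
  have L_sums: "(\<lambda>k. cnj (taylor_coeff h k) * L (disc_monomial k)) sums L h" if h: "h \<in> bergman_space \<alpha>" for h
  proof -
    let ?d = "\<lambda>N z. h z - taylor_sum h N z"
    note d = bergman_space_diff[OF h p]
    have lim: "(\<lambda>N. bergman_norm \<alpha> (?d N)) \<longlonglongrightarrow> 0" by (rule bergman_taylor_sum_tendsto[OF \<alpha> h])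
    have "(\<lambda>N. bergman_norm \<alpha> (T (?d N))) \<longlonglongrightarrow> 0"
    proof (rule Lim_null_comparison)
      show "\<forall>\<^sub>F N in sequentially. norm (bergman_norm \<alpha> (T (?d N))) \<le> C * bergman_norm \<alpha> (?d N)"
        using C d by (simp add: bergman_norm_nonneg)
      show "(\<lambda>N. C * bergman_norm \<alpha> (?d N)) \<longlonglongrightarrow> 0"
        using tendsto_mult_left[OF lim, of C] by simp
    qed
    then have "(\<lambda>N. L (?d N)) \<longlonglongrightarrow> 0 - 0"
      unfolding L_def by (intro tendsto_diff bergman_inner_tendsto_right lim T d f)
    moreover have "L (?d N) = L h - L (taylor_sum h N)" for N
    proof -
      have "T h = T (\<lambda>z. ?d N z + taylor_sum h N z)" by simp
      also have "\<dots> = (\<lambda>z. T (?d N) z + T (taylor_sum h N) z)"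
        by (rule add[rule_format, OF d p])
      finally have "T h = (\<lambda>z. T (?d N) z + T (taylor_sum h N) z)" .
      then show ?thesis
        by (simp add: L_def bergman_inner_diff_right bergman_inner_add_right T d h p f)
    qed
    ultimately have "(\<lambda>N. L h - L (taylor_sum h N)) \<longlonglongrightarrow> 0" by simp
    then have "(\<lambda>N. L h - (L h - L (taylor_sum h N))) \<longlonglongrightarrow> L h - 0"
      by (intro tendsto_intros)
    then show ?thesis by (simp add: sums_def L_poly)
  qed
  have "L (disc_monomial k) = 0" for k
  proof -
    have "of_real (1 / bergman_moment \<alpha> k) * L (disc_monomial k) = 0"
    proof (rule powser_zero_coeff[where c="\<lambda>k. of_real (1 / bergman_moment \<alpha> k) * L (disc_monomial k)"])
      fix w :: complex assume w: "w \<in> unit_disc"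
      have "(\<lambda>k. cnj (taylor_coeff (bergman_kernel \<alpha> 0 w) k) * L (disc_monomial k)) sums L (bergman_kernel \<alpha> 0 w)"
        by (intro L_sums bergman_kernel_in_space \<alpha> w)
      then show "(\<lambda>k. of_real (1 / bergman_moment \<alpha> k) * L (disc_monomial k) * w ^ k) sums 0"
        using ker[OF f w] by (simp add: taylor_coeff_kernel[OF \<alpha> w] L_def mult_ac)
    qed
    then show ?thesis using bergman_moment_pos[OF \<alpha>, of k] by simp
  qed
  then have "L g = 0" using L_sums[OF g] by (simp add: sums_unique2[OF _ sums_zero])
  then show "bergman_inner \<alpha> (T f) g = bergman_inner \<alpha> f (T g)" by (simp add: L_def)
qed

text \<open>
  The left side of the identity is the operator applied to the kernel at \<open>w\<close>, the right side is its
  adjoint applied to the same kernel.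
\<close>

lemma weighted_comp_diff_hermitian_iff:
  assumes \<alpha>: "\<alpha> > -1" and \<phi>: "\<phi> ` unit_disc \<subseteq> unit_disc"
    and bdd: "bergman_bounded_operator \<alpha> (weighted_comp_diff n \<psi> \<phi>)"
  shows "bergman_hermitian \<alpha> (weighted_comp_diff n \<psi> \<phi>) \<longleftrightarrow>
    (\<forall>z\<in>unit_disc. \<forall>w\<in>unit_disc.
       \<psi> z * cnj (bergman_kernel \<alpha> n (\<phi> z) w) = cnj (\<psi> w) * bergman_kernel \<alpha> n (\<phi> w) z)"
    (is "?H \<longleftrightarrow> ?S")
proof -
  let ?T = "weighted_comp_diff n \<psi> \<phi>"
  have \<phi>_in: "\<phi> z \<in> unit_disc" if "z \<in> unit_disc" for z using \<phi> that by blast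
  note adj = bergman_adjoint_kernel[OF \<alpha> _ \<phi>_in bdd]
  have TK: "?T (bergman_kernel \<alpha> 0 w) z = (if z \<in> unit_disc then \<psi> z * cnj (bergman_kernel \<alpha> n (\<phi> z) w) else 0)"
    if "w \<in> unit_disc" for z w
    using higher_deriv_kernel_symmetric[OF \<alpha> that \<phi>_in] by (simp add: weighted_comp_diff_def)
  show ?thesis
  proof
    assume ?H
    show ?S
    proof (intro ballI)
      fix z w :: complex assume z: "z \<in> unit_disc" and w: "w \<in> unit_disc"
      from \<open>?H\<close> bergman_kernel_in_space[OF \<alpha> w, of 0]
      have "?T (bergman_kernel \<alpha> 0 w) z = bergman_adjoint \<alpha> ?T (bergman_kernel \<alpha> 0 w) z"
        by (simp add: bergman_hermitian_def)
      then show "\<psi> z * cnj (bergman_kernel \<alpha> n (\<phi> z) w) = cnj (\<psi> w) * bergman_kernel \<alpha> n (\<phi> w) z"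
        using z by (simp add: TK[OF w] adj[OF w w])
    qed
  next
    assume S: ?S
    show ?H
    proof (rule bergman_hermitianI_kernel[OF \<alpha> bdd])
      fix f w assume f: "f \<in> bergman_space \<alpha>" and w: "w \<in> unit_disc"
      have "?T (bergman_kernel \<alpha> 0 w) = (\<lambda>z. cnj (\<psi> w) * bergman_kernel \<alpha> n (\<phi> w) z)"
      proof
        fix z show "?T (bergman_kernel \<alpha> 0 w) z = cnj (\<psi> w) * bergman_kernel \<alpha> n (\<phi> w) z"
          unfolding TK[OF w] using S w by (auto simp: bergman_kernel_def[of \<alpha> n "\<phi> w" z])
      qed
      then have "bergman_inner \<alpha> f (?T (bergman_kernel \<alpha> 0 w)) = \<psi> w * (deriv ^^ n) f (\<phi> w)"
        by (simp add: bergman_inner_scale_right bergman_reproducing[OF \<alpha> \<phi>_in[OF w] f])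
      also have "\<dots> = ?T f w" using w by (simp add: weighted_comp_diff_def)
      also have "\<dots> = bergman_inner \<alpha> (?T f) (bergman_kernel \<alpha> 0 w)"
        using bergman_reproducing[OF \<alpha> w, of "?T f" 0] bdd f by (simp add: bergman_bounded_operator_def)
      finally show "bergman_inner \<alpha> (?T f) (bergman_kernel \<alpha> 0 w) = bergman_inner \<alpha> f (?T (bergman_kernel \<alpha> 0 w))" ..
    qed
  qed
qed

section \<open>The functional equation for the two symbols\<close>

lemma powr_mult_right_half_plane:
  assumes "0 < Re x" "0 < Re y"
  shows "(x * y) powr s = x powr s * y powr s"
proof -
  have nz: "x \<noteq> 0" "y \<noteq> 0" using assms by auto
  have "\<bar>Im (Ln x)\<bar> < pi / 2" "\<bar>Im (Ln y)\<bar> < pi / 2"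
    using assms nz Re_Ln_pos_lt by blast+
  then have "Ln (x * y) = Ln x + Ln y"
    using nz by (intro Ln_times_simple) auto
  then show ?thesis using nz by (simp add: powr_def distrib_left exp_add)
qed

lemma cnj_powr_of_real: "0 < Re x \<Longrightarrow> cnj (x powr of_real s) = cnj x powr of_real s"
  by (subst cnj_powr) (auto simp: complex_nonpos_Reals_iff)

text \<open>
  Extends identities to the origin after a division by powers of the variable.
\<close>

lemma continuous_disc_zero:
  fixes u :: "complex \<Rightarrow> complex"
  assumes "continuous_on unit_disc u" "\<And>z. z \<in> unit_disc \<Longrightarrow> z \<noteq> 0 \<Longrightarrow> u z = 0"
  shows "u 0 = 0"
proof -
  have "isCont u 0"
    using assms(1) by (simp add: continuous_on_eq_continuous_at)
  then have "(u \<longlongrightarrow> u 0) (at 0)" by (simp add: isCont_def)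
  moreover have "(u \<longlongrightarrow> 0) (at 0)"
  proof (rule tendsto_eventually)
    show "\<forall>\<^sub>F z in at 0. u z = 0"
      unfolding eventually_at using assms(2) by (intro exI[of _ 1]) auto
  qed
  ultimately show ?thesis by (rule LIM_unique)
qed

text \<open>
  The power function with exponent \<open>s\<close> is not injective, so the bases of equal powers may differ. The
  difference of the logarithms of the two products is, however, a holomorphic function with values
  in a discrete set, hence constant, and it vanishes at the origin by \<open>eq0\<close>.
\<close>

lemma powr_eq_imp_eq_on_disc:
  assumes P: "P holomorphic_on unit_disc" "\<And>z. z \<in> unit_disc \<Longrightarrow> 0 < Re (P z)" 
    and Q: "Q holomorphic_on unit_disc" "\<And>z. z \<in> unit_disc \<Longrightarrow> 0 < Re (Q z)" 
    and P': "P' holomorphic_on unit_disc" "\<And>z. z \<in> unit_disc \<Longrightarrow> 0 < Re (P' z)" 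
    and Q': "Q' holomorphic_on unit_disc" "\<And>z. z \<in> unit_disc \<Longrightarrow> 0 < Re (Q' z)" 
    and s: "s \<noteq> 0"
    and eq: "\<And>z. z \<in> unit_disc \<Longrightarrow> P z powr s * Q z powr s = P' z powr s * Q' z powr s"
    and eq0: "P 0 = Q' 0" "Q 0 = P' 0"
    and z: "z \<in> unit_disc"
  shows "P z * Q z = P' z * Q' z"
proof -
  have nn: "w \<notin> \<real>\<^sub>\<le>\<^sub>0" "w \<noteq> 0" if "0 < Re w" for w using that by (auto simp: complex_nonpos_Reals_iff)
  define G where "G z = s * (Ln (P z) + Ln (Q z) - Ln (P' z) - Ln (Q' z))" for z
  have G: "G holomorphic_on unit_disc"
    unfolding G_def using P Q P' Q' nn by (intro holomorphic_intros) auto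
  have expG: "exp (G z) = 1" if "z \<in> unit_disc" for z
  proof -
    have "exp (G z) = (P z powr s * Q z powr s) / (P' z powr s * Q' z powr s)"
      using P(2)[OF that] Q(2)[OF that] P'(2)[OF that] Q'(2)[OF that] nn
      by (simp add: G_def powr_def exp_add exp_diff algebra_simps)
    then show ?thesis using eq[OF that] P'(2)[OF that] Q'(2)[OF that] nn by simp
  qed
  have "(G has_field_derivative 0) (at z within unit_disc)" if "z \<in> unit_disc" for z
  proof -
    have d: "(G has_field_derivative deriv G z) (at z)"
      using G that by (intro holomorphic_derivI[of G unit_disc]) auto
    have "((\<lambda>z. exp (G z)) has_field_derivative exp (G z) * deriv G z) (at z)"
      using d by (auto intro!: derivative_eq_intros)
    moreover have "((\<lambda>z. exp (G z)) has_field_derivative 0) (at z)"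
    proof (rule has_field_derivative_transform_within_open[where f="\<lambda>_. 1" and S=unit_disc])
      show "((\<lambda>_. 1) has_field_derivative 0) (at z)" by simp
    qed (use that expG in auto)
    ultimately have "exp (G z) * deriv G z = 0" by (rule DERIV_unique)
    then show ?thesis using d by (auto intro: has_field_derivative_at_within)
  qed
  then obtain c where c: "\<And>z. z \<in> unit_disc \<Longrightarrow> G z = c"
    using has_field_derivative_zero_constant[of unit_disc G] by auto
  have "G 0 = 0" by (simp add: G_def eq0)
  then have "G z = 0" using c[of 0] c[OF z] by simp
  then have "Ln (P z) + Ln (Q z) = Ln (P' z) + Ln (Q' z)" using s by (simp add: G_def diff_eq_eq)
  then have "exp (Ln (P z) + Ln (Q z)) = exp (Ln (P' z) + Ln (Q' z))" by simp
  then show ?thesis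
    using P(2)[OF z] Q(2)[OF z] P'(2)[OF z] Q'(2)[OF z] nn by (simp add: exp_add)
qed

text \<open>
  After multiplication by the denominators, the claim is that \<open>(1 - cnj b * z) * (1 - cnj w * \<phi> z)\<close> is
  invariant under the exchange of \<open>z\<close> and \<open>w\<close> followed by conjugation. It equals
  \<open>1 - cnj b * z - b * cnj w + (|b|\<^sup>2 - c) * z * cnj w\<close>, where the invariance is the reality of \<open>c\<close>.
\<close>

lemma kernel_symmetryI:
  fixes a c s :: real
  assumes b: "b \<in> unit_disc" and \<phi>: "\<phi> ` unit_disc \<subseteq> unit_disc"
    and \<psi>_eq: "\<And>z. z \<in> unit_disc \<Longrightarrow> \<psi> z = of_real a * z ^ n / (1 - cnj b * z) powr of_real s"
    and \<phi>_eq: "\<And>z. z \<in> unit_disc \<Longrightarrow> \<phi> z = b + of_real c * z / (1 - cnj b * z)"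
    and z: "z \<in> unit_disc" and w: "w \<in> unit_disc"
  shows "\<psi> z * cnj w ^ n * (1 - cnj (\<phi> w) * z) powr of_real s =
    cnj (\<psi> w) * z ^ n * (1 - cnj w * \<phi> z) powr of_real s"
proof -
  have \<phi>_in: "cmod (\<phi> u) < 1" if "u \<in> unit_disc" for u using \<phi> that by force
  define X where "X = 1 - cnj b * z"
  define Y where "Y = 1 - cnj w * \<phi> z"
  define X' where "X' = 1 - b * cnj w"
  define Y' where "Y' = 1 - cnj (\<phi> w) * z"
  have X: "0 < Re X" and Y: "0 < Re Y" and Y': "0 < Re Y'"
    unfolding X_def Y_def Y'_def using b z w \<phi>_in[OF z] \<phi>_in[OF w]
    by (auto intro!: Re_one_minus_pos simp del: minus_complex.simps)
  have X'c: "X' = cnj (1 - cnj b * w)" by (simp add: X'_def)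
  have Xw: "0 < Re (1 - cnj b * w)" using b w by (intro Re_one_minus_pos) auto
  then have X': "0 < Re X'" unfolding X'c by simp
  have nz: "X \<noteq> 0" "X' \<noteq> 0" using X X' by auto
  have e1: "X * \<phi> z = b * X + of_real c * z"
    using nz \<phi>_eq[OF z] by (simp add: X_def field_simps)
  have e2: "X' * cnj (\<phi> w) = cnj b * X' + of_real c * cnj w"
    using nz \<phi>_eq[OF w] by (simp add: X'_def field_simps)
  have "X * Y = X - cnj w * (X * \<phi> z)" by (simp add: Y_def algebra_simps)
  also have "\<dots> = X' - z * (X' * cnj (\<phi> w))"
    unfolding e1 e2 by (simp add: X_def X'_def algebra_simps)
  also have "\<dots> = X' * Y'" by (simp add: Y'_def algebra_simps)
  finally have XY: "X powr of_real s * Y powr of_real s = X' powr of_real s * Y' powr of_real s"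
    using X X' Y Y' by (simp flip: powr_mult_right_half_plane)
  have pz: "\<psi> z = of_real a * z ^ n / X powr of_real s" using \<psi>_eq[OF z] by (simp add: X_def)
  have pw: "cnj (\<psi> w) = of_real a * cnj w ^ n / X' powr of_real s"
    using \<psi>_eq[OF w] by (simp add: X'c cnj_powr_of_real[OF Xw] del: complex_cnj_diff)
  have "X powr of_real s \<noteq> 0" "X' powr of_real s \<noteq> 0" using nz by (auto simp: powr_def)
  then show ?thesis
    unfolding pz pw Y_def[symmetric] Y'_def[symmetric]
    using XY by (simp add: divide_simps) (simp add: mult_ac)
qed

text \<open>
  Fixing a point \<open>w0\<close> with \<open>\<psi> w0 \<noteq> 0\<close> in the functional equation shows that \<open>\<psi> z = z ^ n * h z\<close> with \<open>h\<close>
  continuous and \<open>h 0 \<noteq> 0\<close>. The equation for \<open>h\<close> can then be evaluated at \<open>w = 0\<close>, which determines \<open>h\<close>, and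
  thereby \<open>\<psi>\<close>, up to the real constant \<open>h 0\<close>. When this is inserted, only an identity between powers is
  left. Removing the exponent gives \<open>z * cnj (g w) = cnj w * g z\<close> for \<open>g z = (\<phi> z - b) * (1 - cnj b * z)\<close>, so
  \<open>g\<close> is a real multiple of the identity.
\<close>

lemma kernel_symmetryD:
  fixes s :: real
  assumes n: "n \<ge> 1" and s: "s > 0"
    and hol: "\<phi> holomorphic_on unit_disc" and \<phi>: "\<phi> ` unit_disc \<subseteq> unit_disc"
    and nonzero: "\<exists>z\<in>unit_disc. \<psi> z \<noteq> 0"
    and sym: "\<And>z w. z \<in> unit_disc \<Longrightarrow> w \<in> unit_disc \<Longrightarrow>
       \<psi> z * cnj w ^ n * (1 - cnj (\<phi> w) * z) powr of_real s =
       cnj (\<psi> w) * z ^ n * (1 - cnj w * \<phi> z) powr of_real s"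
  shows "\<exists>(a::real) (c::real). \<exists>b\<in>unit_disc. \<forall>z\<in>unit_disc.
       \<psi> z = of_real a * z ^ n / (1 - cnj b * z) powr of_real s \<and>
       \<phi> z = b + of_real c * z / (1 - cnj b * z)"
proof -
  have \<phi>_in: "cmod (\<phi> u) < 1" if "u \<in> unit_disc" for u using \<phi> that by force
  have \<phi>_cont: "continuous_on unit_disc \<phi>" using hol by (rule holomorphic_on_imp_continuous_on)
  have pos: "0 < Re (1 - cnj (\<phi> w) * z)" "0 < Re (1 - cnj w * \<phi> z)" if "z \<in> unit_disc" "w \<in> unit_disc" for z w
    using that \<phi>_in[of z] \<phi>_in[of w] Re_one_minus_pos[of "\<phi> w" z] Re_one_minus_pos[of w "\<phi> z"] by auto
  have nn: "x \<notin> \<real>\<^sub>\<le>\<^sub>0" "x \<noteq> 0" "x powr of_real s \<noteq> 0" if "0 < Re x" for x 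
    using that by (auto simp: complex_nonpos_Reals_iff powr_def)
  obtain w0 where w0: "w0 \<in> unit_disc" "\<psi> w0 \<noteq> 0" using nonzero by blast
  \<comment> \<open>This is where \<open>n \<ge> 1\<close> enters.\<close>
  have "\<psi> 0 = 0"
    using sym[of 0 "1/2"] n by (simp add: power_0_left)
  with w0 have w0_nz: "w0 \<noteq> 0" by auto
  define h where "h z = cnj (\<psi> w0) * (1 - cnj w0 * \<phi> z) powr of_real s / (cnj w0 ^ n * (1 - cnj (\<phi> w0) * z) powr of_real s)" for z
  have \<psi>_h: "\<psi> z = z ^ n * h z" if "z \<in> unit_disc" for z
    using sym[OF that w0(1)] w0 w0_nz nn(3)[OF pos(1)[OF that w0(1)]]
    by (simp add: h_def field_simps)
  have "continuous_on unit_disc h"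
    unfolding h_def using w0_nz w0 pos[OF _ w0(1)] nn cnj_mult_neq_1[OF \<phi>_in[OF w0(1)]]
    by (intro holomorphic_on_imp_continuous_on holomorphic_intros hol) auto
  note cont = this \<phi>_cont
  have h0_nz: "h 0 \<noteq> 0"
    using w0 w0_nz nn(3)[OF pos(2)[OF _ w0(1), of 0]] by (simp add: h_def)
  have h_sym: "h z * (1 - cnj (\<phi> w) * z) powr of_real s = cnj (h w) * (1 - cnj w * \<phi> z) powr of_real s"
    if "z \<in> unit_disc" "w \<in> unit_disc" "z \<noteq> 0" "w \<noteq> 0" for z w
    using sym[OF that(1,2)] that(3,4) unfolding \<psi>_h[OF that(1)] \<psi>_h[OF that(2)] by simp
  define b where "b = \<phi> 0"
  have b: "b \<in> unit_disc" using \<phi>_in[of 0] by (simp add: b_def)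
  have bpos: "0 < Re (1 - cnj b * z)" if "z \<in> unit_disc" for z
    using b that by (intro Re_one_minus_pos) auto
  have h_at_0: "h z * (1 - cnj b * z) powr of_real s = cnj (h 0)" if z: "z \<in> unit_disc" "z \<noteq> 0" for z
  proof -
    let ?u = "\<lambda>w. h z * (1 - cnj (\<phi> w) * z) powr of_real s - cnj (h w) * (1 - cnj w * \<phi> z) powr of_real s"
    \<comment> \<open>The functional equation extends to \<open>w = 0\<close> by continuity.\<close>
    have "?u 0 = 0"
    proof (rule continuous_disc_zero)
      show "continuous_on unit_disc ?u"
        using pos[OF z(1)] s by (intro continuous_intros cont continuous_on_powr_complex) (auto intro: less_imp_le)
    qed (use h_sym z in auto)
    then show ?thesis by (simp add: b_def)
  qed
  have "h 0 * (1 - cnj b * 0) powr of_real s - cnj (h 0) = 0"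
  proof (rule continuous_disc_zero[where u="\<lambda>z. h z * (1 - cnj b * z) powr of_real s - cnj (h 0)"])
    show "continuous_on unit_disc (\<lambda>z. h z * (1 - cnj b * z) powr of_real s - cnj (h 0))"
      using bpos s by (intro continuous_intros cont continuous_on_powr_complex) (auto intro: less_imp_le)
  qed (use h_at_0 in auto)
  then have h0_cnj: "cnj (h 0) = h 0" by simp
  then obtain a :: real where a: "h 0 = of_real a" using Reals_cnj_iff[of "h 0"] by (auto elim: Reals_cases)
  have a_nz: "a \<noteq> 0" using h0_nz a by auto
  have h_eq: "h z = of_real a / (1 - cnj b * z) powr of_real s" if "z \<in> unit_disc" for z
  proof (cases "z = 0")
    case False
    with h_at_0[OF that] nn(3)[OF bpos[OF that]] show ?thesis by (simp add: a field_simps)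
  qed (simp add: a)
  have XY: "(1 - cnj w * \<phi> z) * (1 - cnj b * z) = (1 - cnj (\<phi> w) * z) * (1 - b * cnj w)"
    if z: "z \<in> unit_disc" and w: "w \<in> unit_disc" "w \<noteq> 0" for z w
  proof (rule powr_eq_imp_eq_on_disc[where P="\<lambda>z. 1 - cnj w * \<phi> z" and Q="\<lambda>z. 1 - cnj b * z"
      and P'="\<lambda>z. 1 - cnj (\<phi> w) * z" and Q'="\<lambda>z. 1 - b * cnj w" and s="of_real s", OF _ _ _ _ _ _ _ _ _ _ _ _ z])
    have Xw: "0 < Re (1 - cnj b * w)" by (rule bpos[OF w(1)])
    have Xc: "1 - b * cnj w = cnj (1 - cnj b * w)" by simp
    show X'pos: "0 < Re (1 - b * cnj w)" unfolding Xc using Xw by simp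
    fix z assume z: "z \<in> unit_disc"
    show "(1 - cnj w * \<phi> z) powr of_real s * (1 - cnj b * z) powr of_real s =
        (1 - cnj (\<phi> w) * z) powr of_real s * (1 - b * cnj w) powr of_real s"
    proof (cases "z = 0")
      case True
      then show ?thesis by (simp add: b_def mult_ac)
    next
      case False
      have hw: "cnj (h w) = of_real a / (1 - b * cnj w) powr of_real s"
        unfolding h_eq[OF w(1)] Xc using cnj_powr_of_real[OF Xw] by (simp del: complex_cnj_diff)
      show ?thesis
        using h_sym[OF z w(1) False w(2)] a_nz nn(3)[OF bpos[OF z]] nn(3)[OF X'pos]
        unfolding hw h_eq[OF z] by (simp add: field_simps)
    qed
  qed (use bpos pos w(1) s hol in \<open>auto intro!: holomorphic_intros simp: b_def mult_ac simp del: minus_complex.simps\<close>)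
  define g where "g z = (\<phi> z - b) * (1 - cnj b * z)" for z
  have g_sym: "z * cnj (g w) = cnj w * g z" if "z \<in> unit_disc" "w \<in> unit_disc" "w \<noteq> 0" for z w
    using XY[OF that] by (simp add: g_def algebra_simps)
  \<comment> \<open>Any nonzero real point of the disc would serve in place of \<open>1/2\<close>.\<close>
  have half: "(1/2 :: complex) \<in> unit_disc" by simp
  have "cnj (g (1/2)) = g (1/2)" using g_sym[OF half half] by simp
  then obtain c' :: real where c': "g (1/2) = of_real c'" using Reals_cnj_iff[of "g (1/2)"] by (auto elim: Reals_cases)
  have g_eq: "g z = of_real (2 * c') * z" if "z \<in> unit_disc" for z
    using g_sym[OF that half] by (simp add: c' field_simps)
  have "\<phi> z = b + of_real (2 * c') * z / (1 - cnj b * z)" if "z \<in> unit_disc" for z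
    using g_eq[OF that] nn(2)[OF bpos[OF that]] by (simp add: g_def field_simps)
  with b \<psi>_h h_eq show ?thesis
    by (intro exI[of _ a] exI[of _ "2 * c'"] bexI[of _ b]) (auto simp: mult_ac)
qed

theorem theorem2p4:
  fixes \<alpha> :: real and n :: nat and \<phi> \<psi> :: "complex \<Rightarrow> complex"
  assumes "\<alpha> > -1" and "n \<ge> 1"
    and "\<phi> holomorphic_on unit_disc" and "\<phi> ` unit_disc \<subseteq> unit_disc"
    and "\<psi> holomorphic_on unit_disc" and "\<exists>z\<in>unit_disc. \<psi> z \<noteq> 0"
    and "bergman_bounded_operator \<alpha> (weighted_comp_diff n \<psi> \<phi>)"
  shows "bergman_hermitian \<alpha> (weighted_comp_diff n \<psi> \<phi>) \<longleftrightarrow>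
    (\<exists>(a::real) (c::real). \<exists>b\<in>unit_disc. \<forall>z\<in>unit_disc.
       \<psi> z = of_real a * z ^ n / (1 - cnj b * z) powr of_real (real n + \<alpha> + 2) \<and>
       \<phi> z = b + of_real c * z / (1 - cnj b * z))"
    (is "_ \<longleftrightarrow> ?form")
proof -
  define s where "s = real n + \<alpha> + 2"
  let ?sym = "\<lambda>z w. \<psi> z * cnj w ^ n * (1 - cnj (\<phi> w) * z) powr of_real s =
       cnj (\<psi> w) * z ^ n * (1 - cnj w * \<phi> z) powr of_real s"
  have s: "s > 0" using assms(1) by (simp add: s_def)
  have "\<psi> z * cnj (bergman_kernel \<alpha> n (\<phi> z) w) = cnj (\<psi> w) * bergman_kernel \<alpha> n (\<phi> w) z \<longleftrightarrow> ?sym z w"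
    if z: "z \<in> unit_disc" and w: "w \<in> unit_disc" for z w
  proof -
    define p where "p = complex_of_real (pochhammer (\<alpha> + 2) n)"
    define Y where "Y = (1 - cnj w * \<phi> z) powr of_real s"
    define Y' where "Y' = (1 - cnj (\<phi> w) * z) powr of_real s"
    have \<phi>z: "cmod (\<phi> z) < 1" "cmod (\<phi> w) < 1" using assms(4) z w by force+
    have p: "p \<noteq> 0" using pochhammer_pos[of "\<alpha> + 2" n] assms(1) by (simp add: p_def)
    have r: "0 < Re (1 - cnj (\<phi> z) * w)" using \<phi>z w by (intro Re_one_minus_pos) auto
    have "cnj w * \<phi> z \<noteq> 1" "cnj (\<phi> w) * z \<noteq> 1"
      using \<phi>z w z cnj_mult_neq_1[of w "\<phi> z"] cnj_mult_neq_1[of "\<phi> w" z] by auto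
    then have nz: "Y \<noteq> 0" "Y' \<noteq> 0" by (simp_all add: Y_def Y'_def powr_def)
    have k1: "cnj (bergman_kernel \<alpha> n (\<phi> z) w) = p * cnj w ^ n / Y"
      using w cnj_powr_of_real[OF r, of s]
      by (simp add: bergman_kernel_def p_def Y_def mult.commute flip: s_def of_real_add)
    have k2: "bergman_kernel \<alpha> n (\<phi> w) z = p * z ^ n / Y'"
      using z by (simp add: bergman_kernel_def p_def Y'_def flip: s_def)
    show ?thesis
      unfolding k1 k2 Y_def[symmetric] Y'_def[symmetric] using p nz by (simp add: field_simps)
  qed
  then have "bergman_hermitian \<alpha> (weighted_comp_diff n \<psi> \<phi>) \<longleftrightarrow> (\<forall>z\<in>unit_disc. \<forall>w\<in>unit_disc. ?sym z w)"
    using weighted_comp_diff_hermitian_iff[OF assms(1,4,7)] by simp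
  also have "\<dots> \<longleftrightarrow> ?form"
    unfolding s_def[symmetric]
    using kernel_symmetryD[OF assms(2) s assms(3,4,6)] kernel_symmetryI[OF _ assms(4)] by blast
  finally show ?thesis .
qed

end
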